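(* Let $(\mathcal{F},\mathcal{G})$ be an LE-signature, $\epsilon$ an order-type and $\Omega$ a strict partial order on the propositional variables. Every $\tau_\epsilon$-transferable analytic $(\Omega,\epsilon)$-inductive $\mathcal{L}_{\mathrm{DLE}}$-inequality $\phi\leq\psi$ is canonical: for every normal distributive lattice expansion $\mathbb{A}$ of this signature, if $\phi\leq\psi$ holds in $\mathbb{A}$ under all assignments, then it holds in the canonical extension $\mathbb{A}^\delta$ under all assignments.
   Context: Signature and terms. An order-type over $n$ is $\epsilon\in\{1,\partial\}^n$; $\epsilon^\partial$ is its opposite. For a lattice $A$, $A^1=A$, $A^\partial$ its order dual, $A^\epsilon=\prod_i A^{\epsilon(i)}$ with product order $\leq^\epsilon$. An LE-signature consists of disjoint sets $\mathcal{F},\mathcal{G}$ of connectives, each $h$ with arity $n_h$ and order-type $\epsilon_h$ over $n_h$. $\mathcal{L}_{\mathrm{DLE}}$-terms: $\phi::=p\mid\bot\mid\top\mid\phi\wedge\phi\mid\phi\vee\phi\mid f(\overline{\phi})\mid g(\overline{\phi})$, $p\in\mathsf{PROP}$. Normal DLEs and canonical extensions. A normal DLE is $\mathbb{A}=(A,\{f^{\mathbb{A}}\},\{g^{\mathbb{A}}\})$ with $A$ a bounded distributive lattice, each $f^{\mathbb{A}}:A^{n_f}\to A$ preserving finite (including empty) joins in each coordinate with $\epsilon_f(i)=1$ and turning finite (including empty) meets into joins in each coordinate with $\epsilon_f(i)=\partial$, and each $g^{\mathbb{A}}$ preserving finite meets in coordinates with $\epsilon_g(i)=1$ and turning finite joins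 into meets in coordinates with $\epsilon_g(i)=\partial$. The canonical extension $A^\delta$ of $A$ is the complete lattice containing $A$ as a dense (every element is a join of meets and a meet of joins of elements of $A$) and compact (if $\bigwedge S\leq\bigvee T$ for $S,T\subseteq A$ then $\bigwedge S'\leq\bigvee T'$ for finite $S'\subseteq S,T'\subseteq T$) sublattice; closed elements $K(A^\delta)$ are meets, open elements $O(A^\delta)$ joins, of subsets of $A$; $K((A^\delta)^\epsilon)$ is the product with $K(A^\delta)$ in coordinates with $\epsilon(i)=1$ and $O(A^\delta)$ in those with $\epsilon(i)=\partial$, and dually for $O((A^\delta)^\epsilon)$. $f^\sigma(\overline{k})=\bigwedge\{f(\overline{a})\mid\overline{a}\in A^{\epsilon_f},\overline{k}\leq^{\epsilon_f}\overline{a}\}$ for $\overline{k}\in K((A^\delta)^{\epsilon_f})$ and $f^\sigma(\overline{u})=\bigvee\{f^\sigma(\overline{k})\mid\overline{k}\in K((A^\delta)^{\epsilon_f}),\overline{k}\leq^{\epsilon_f}\overline{u}\}$; $g^\pi$ is defined order-dually using open elements. $\mathbb{A}^\delta=(A^\delta,\{(f^{\mathbb{A}})^\sigma\},\{(g^{\mathbb{A}})^\pi\})$. Analytic inductive inequalities (with the following node classification). Signed generation trees: the root of the generation tree of $s$ gets sign $+$ (resp. $-$); children of $\vee,\wedge$ get the parent's sign; the $i$-th child of an $h$-node gets the same sign if $\epsilon_h(i)=1$, the opposite if $\epsilon_h(i)=\partial$; for $s\leq t$ consider $+s$ and $-t$. Skeleton nodes: $+\vee,-\wedge,+f\ (f\in\mathcal{F}),-g\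 (g\in\mathcal{G})$. PIA nodes: $+\wedge,-\vee,+g,-f$; SRR nodes are $+g$ with $n_g\geq2$ and $-f$ with $n_f\geq2$. A branch (leaf-to-root path) is good if it consists of a path from the leaf through PIA nodes only, followed by a path to the root through Skeleton nodes only (either possibly empty). A leaf is $\epsilon$-critical if it is $+p$ with $\epsilon(p)=1$ or $-p$ with $\epsilon(p)=\partial$; a signed subtree agrees with $\epsilon^\partial$ if all its variable leaves are $\epsilon^\partial$-critical. $*s$ is $(\Omega,\epsilon)$-inductive if every branch ending in an $\epsilon$-critical leaf $p_i$ is good and, for each SRR node $\circledast(\gamma_1,\ldots,\beta,\ldots,\gamma_m)$ on it ($\beta$ on the branch), each $\gamma_h$ agrees with $\epsilon^\partial$ and all variables $p_k$ in $\gamma_h$ satisfy $p_k<_\Omega p_i$; it is analytic $(\Omega,\epsilon)$-inductive if moreover all its branches are good; $s\leq t$ is analytic $(\Omega,\epsilon)$-inductive if $+s$ and $-t$ are. Transferability. In $+s$ and $-t$ for an analytic $(\Omega,\epsilon)$-inductive $s\leq t$, a maximal PIA-subterm is a signed subtree whose root is not a Skeleton node, whose internal nodes are all PIA nodes, and whose parent (if any) is a Skeleton node. The inequality is $\tau_\epsilon$-transferable if every maximal PIA-subterm containing no $\epsilon$-critical leaf either contains no propositional variables at all, or is a single leaf: a variable $q$ with $\epsilon(q)=\partial$ if its sign is $+$, or a variable $p$ with $\epsilon(p)=1$ if its sign is $-$. *)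

theory Defs
  imports Main
begin

section \<open>Signatures and terms\<close>

datatype variance = One | Dual

fun opp :: "variance \<Rightarrow> variance" where
  "opp One = Dual"
| "opp Dual = One"

text \<open>The arity of a connective is the length of its order-type.\<close>

record 'c signature =
  fconn :: "'c set"
  gconn :: "'c set"
  otype :: "'c \<Rightarrow> variance list"

definition arity :: "'c signature \<Rightarrow> 'c \<Rightarrow> nat" where
  "arity S h = length (otype S h)"

definition le_signature :: "'c signature \<Rightarrow> bool" where
  "le_signature S \<longleftrightarrow> fconn S \<inter> gconn S = {}"

datatype ('c, vars: 'v) trm =
    is_Var: Var 'v
  | Bot
  | Top
  | Conj "('c, 'v) trm" "('c, 'v) trm"
  | Disj "('c, 'v) trm" "('c, 'v) trm"
  | Op 'c "('c, 'v) trm list"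

primrec wf_trm :: "'c signature \<Rightarrow> ('c, 'v) trm \<Rightarrow> bool" where
  "wf_trm S (Var p) = True"
| "wf_trm S Bot = True"
| "wf_trm S Top = True"
| "wf_trm S (Conj s t) = (wf_trm S s \<and> wf_trm S t)"
| "wf_trm S (Disj s t) = (wf_trm S s \<and> wf_trm S t)"
| "wf_trm S (Op h ts) =
     (h \<in> fconn S \<union> gconn S \<and> length ts = arity S h \<and> list_all (wf_trm S) ts)"

primrec eval ::
  "('c \<Rightarrow> 'a list \<Rightarrow> 'a) \<Rightarrow> ('v \<Rightarrow> 'a) \<Rightarrow> ('c, 'v) trm \<Rightarrow> 'a::bounded_lattice" where
  "eval I v (Var p) = v p"
| "eval I v Bot = bot"
| "eval I v Top = top"
| "eval I v (Conj s t) = inf (eval I v s) (eval I v t)"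
| "eval I v (Disj s t) = sup (eval I v s) (eval I v t)"
| "eval I v (Op h ts) = I h (map (eval I v) ts)"

definition holds_in ::
  "('c \<Rightarrow> 'a list \<Rightarrow> 'a::bounded_lattice) \<Rightarrow> ('c, 'v) trm \<Rightarrow> ('c, 'v) trm \<Rightarrow> bool" where
  "holds_in I s t \<longleftrightarrow> (\<forall>v. eval I v s \<le> eval I v t)"


section \<open>Normal lattice expansions\<close>

text \<open>Operations are functions on lists; only their values on lists whose length is the arity
  are meaningful. Preservation of finite joins (meets) is stated for the empty and the
  binary ones.\<close>

definition f_normal :: "variance list \<Rightarrow> ('a list \<Rightarrow> 'a::bounded_lattice) \<Rightarrow> bool" where
  "f_normal \<epsilon> f \<longleftrightarrow> (\<forall>as i. length as = length \<epsilon> \<and> i < length \<epsilon> \<longrightarrow>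
     (case \<epsilon> ! i of
        One \<Rightarrow> f (as[i := bot]) = bot \<and>
               (\<forall>x y. f (as[i := sup x y]) = sup (f (as[i := x])) (f (as[i := y])))
      | Dual \<Rightarrow> f (as[i := top]) = bot \<and>
               (\<forall>x y. f (as[i := inf x y]) = sup (f (as[i := x])) (f (as[i := y])))))"

definition g_normal :: "variance list \<Rightarrow> ('a list \<Rightarrow> 'a::bounded_lattice) \<Rightarrow> bool" where
  "g_normal \<epsilon> g \<longleftrightarrow> (\<forall>as i. length as = length \<epsilon> \<and> i < length \<epsilon> \<longrightarrow>
     (case \<epsilon> ! i of
        One \<Rightarrow> g (as[i := top]) = top \<and>
               (\<forall>x y. g (as[i := inf x y]) = inf (g (as[i := x])) (g (as[i := y])))
      | Dual \<Rightarrow> g (as[i := bot]) = top \<and>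
               (\<forall>x y. g (as[i := sup x y]) = inf (g (as[i := x])) (g (as[i := y])))))"

definition normal_dle ::
  "'c signature \<Rightarrow> ('c \<Rightarrow> 'a list \<Rightarrow> 'a::{distrib_lattice, bounded_lattice}) \<Rightarrow> bool" where
  "normal_dle S I \<longleftrightarrow>
     (\<forall>f \<in> fconn S. f_normal (otype S f) (I f)) \<and>
     (\<forall>g \<in> gconn S. g_normal (otype S g) (I g))"


section \<open>Canonical extensions\<close>

text \<open>The inclusion of the lattice into its canonical extension is rendered as an embedding
  between two types.\<close>

definition bounded_lattice_embedding ::
  "('a::bounded_lattice \<Rightarrow> 'd::bounded_lattice) \<Rightarrow> bool" where
  "bounded_lattice_embedding e \<longleftrightarrow> inj e \<and> e bot = bot \<and> e top = top \<and>
     (\<forall>x y. e (inf x y) = inf (e x) (e y)) \<and> (\<forall>x y. e (sup x y) = sup (e x) (e y))"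

definition closed_elems :: "('a \<Rightarrow> 'd::complete_lattice) \<Rightarrow> 'd set" where
  "closed_elems e = {Inf (e ` X) | X. True}"

definition open_elems :: "('a \<Rightarrow> 'd::complete_lattice) \<Rightarrow> 'd set" where
  "open_elems e = {Sup (e ` X) | X. True}"

definition dense_embedding :: "('a \<Rightarrow> 'd::complete_lattice) \<Rightarrow> bool" where
  "dense_embedding e \<longleftrightarrow> (\<forall>u.
     (\<exists>X \<subseteq> closed_elems e. u = Sup X) \<and> (\<exists>Y \<subseteq> open_elems e. u = Inf Y))"

definition compact_embedding :: "('a \<Rightarrow> 'd::complete_lattice) \<Rightarrow> bool" where
  "compact_embedding e \<longleftrightarrow> (\<forall>X Y. Inf (e ` X) \<le> Sup (e ` Y) \<longrightarrow>
     (\<exists>X' Y'. finite X' \<and> X' \<subseteq> X \<and> finite Y' \<and> Y' \<subseteq> Y \<and> Inf (e ` X') \<le> Sup (e ` Y')))"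

definition canonical_extension ::
  "('a::bounded_lattice \<Rightarrow> 'd::complete_lattice) \<Rightarrow> bool" where
  "canonical_extension e \<longleftrightarrow>
     bounded_lattice_embedding e \<and> dense_embedding e \<and> compact_embedding e"

definition le_otype :: "variance list \<Rightarrow> 'a::order list \<Rightarrow> 'a list \<Rightarrow> bool" where
  "le_otype \<epsilon> xs ys \<longleftrightarrow> length xs = length \<epsilon> \<and> length ys = length \<epsilon> \<and>
     (\<forall>i < length \<epsilon>. case \<epsilon> ! i of One \<Rightarrow> xs ! i \<le> ys ! i | Dual \<Rightarrow> ys ! i \<le> xs ! i)"

definition closed_tuples ::
  "('a \<Rightarrow> 'd::complete_lattice) \<Rightarrow> variance list \<Rightarrow> 'd list set" where
  "closed_tuples e \<epsilon> = {ks. length ks = length \<epsilon> \<and>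
     (\<forall>i < length \<epsilon>. ks ! i \<in> (case \<epsilon> ! i of One \<Rightarrow> closed_elems e | Dual \<Rightarrow> open_elems e))}"

definition open_tuples ::
  "('a \<Rightarrow> 'd::complete_lattice) \<Rightarrow> variance list \<Rightarrow> 'd list set" where
  "open_tuples e \<epsilon> = {os. length os = length \<epsilon> \<and>
     (\<forall>i < length \<epsilon>. os ! i \<in> (case \<epsilon> ! i of One \<Rightarrow> open_elems e | Dual \<Rightarrow> closed_elems e))}"

definition sigma_closed ::
  "('a \<Rightarrow> 'd::complete_lattice) \<Rightarrow> variance list \<Rightarrow> ('a list \<Rightarrow> 'a) \<Rightarrow> 'd list \<Rightarrow> 'd" where
  "sigma_closed e \<epsilon> f ks = Inf {e (f as) | as. le_otype \<epsilon> ks (map e as)}"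

definition sigma_ext ::
  "('a \<Rightarrow> 'd::complete_lattice) \<Rightarrow> variance list \<Rightarrow> ('a list \<Rightarrow> 'a) \<Rightarrow> 'd list \<Rightarrow> 'd" where
  "sigma_ext e \<epsilon> f us =
     Sup {sigma_closed e \<epsilon> f ks | ks. ks \<in> closed_tuples e \<epsilon> \<and> le_otype \<epsilon> ks us}"

definition pi_open ::
  "('a \<Rightarrow> 'd::complete_lattice) \<Rightarrow> variance list \<Rightarrow> ('a list \<Rightarrow> 'a) \<Rightarrow> 'd list \<Rightarrow> 'd" where
  "pi_open e \<epsilon> g os = Sup {e (g as) | as. le_otype \<epsilon> (map e as) os}"

definition pi_ext ::
  "('a \<Rightarrow> 'd::complete_lattice) \<Rightarrow> variance list \<Rightarrow> ('a list \<Rightarrow> 'a) \<Rightarrow> 'd list \<Rightarrow> 'd" where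
  "pi_ext e \<epsilon> g us =
     Inf {pi_open e \<epsilon> g os | os. os \<in> open_tuples e \<epsilon> \<and> le_otype \<epsilon> us os}"

definition canext_ops ::
  "'c signature \<Rightarrow> ('a \<Rightarrow> 'd::complete_lattice) \<Rightarrow> ('c \<Rightarrow> 'a list \<Rightarrow> 'a) \<Rightarrow> 'c \<Rightarrow> 'd list \<Rightarrow> 'd" where
  "canext_ops S e I h =
     (if h \<in> fconn S then sigma_ext e (otype S h) (I h) else pi_ext e (otype S h) (I h))"


section \<open>Signed generation trees\<close>

datatype sign = Plus | Minus

text \<open>A node of a signed generation tree is represented by the signed subterm rooted at it.\<close>

type_synonym ('c, 'v) strm = "sign \<times> ('c, 'v) trm"

fun child_sign :: "variance \<Rightarrow> sign \<Rightarrow> sign" where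
  "child_sign One \<sigma> = \<sigma>"
| "child_sign Dual Plus = Minus"
| "child_sign Dual Minus = Plus"

fun children :: "'c signature \<Rightarrow> ('c, 'v) strm \<Rightarrow> ('c, 'v) strm list" where
  "children S (\<sigma>, Conj s t) = [(\<sigma>, s), (\<sigma>, t)]"
| "children S (\<sigma>, Disj s t) = [(\<sigma>, s), (\<sigma>, t)]"
| "children S (\<sigma>, Op h ts) = zip (map (\<lambda>\<eta>. child_sign \<eta> \<sigma>) (otype S h)) ts"
| "children S (\<sigma>, _) = []"

definition is_leaf :: "'c signature \<Rightarrow> ('c, 'v) strm \<Rightarrow> bool" where
  "is_leaf S x \<longleftrightarrow> children S x = []"

text \<open>\<open>path S x p y\<close>: the node \<open>y\<close> is reached from \<open>x\<close> along \<open>p\<close>, the list, starting at \<open>x\<close>, of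
  the nodes strictly above \<open>y\<close>, each paired with the index of the child where the path goes on.
  The index distinguishes different occurrences of the same signed subterm.\<close>

inductive path ::
  "'c signature \<Rightarrow> ('c, 'v) strm \<Rightarrow> (('c, 'v) strm \<times> nat) list \<Rightarrow> ('c, 'v) strm \<Rightarrow> bool"
  for S where
  path_Nil: "path S x [] x"
| path_Cons: "i < length (children S x) \<Longrightarrow> path S (children S x ! i) p y \<Longrightarrow>
    path S x ((x, i) # p) y"

fun is_skeleton :: "'c signature \<Rightarrow> ('c, 'v) strm \<Rightarrow> bool" where
  "is_skeleton S (Plus, Disj s t) = True"
| "is_skeleton S (Minus, Conj s t) = True"
| "is_skeleton S (Plus, Op h ts) = (h \<in> fconn S)"
| "is_skeleton S (Minus, Op h ts) = (h \<in> gconn S)"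
| "is_skeleton S _ = False"

fun is_pia :: "'c signature \<Rightarrow> ('c, 'v) strm \<Rightarrow> bool" where
  "is_pia S (Plus, Conj s t) = True"
| "is_pia S (Minus, Disj s t) = True"
| "is_pia S (Plus, Op h ts) = (h \<in> gconn S)"
| "is_pia S (Minus, Op h ts) = (h \<in> fconn S)"
| "is_pia S _ = False"

fun is_srr :: "'c signature \<Rightarrow> ('c, 'v) strm \<Rightarrow> bool" where
  "is_srr S (Plus, Op h ts) = (h \<in> gconn S \<and> arity S h \<ge> 2)"
| "is_srr S (Minus, Op h ts) = (h \<in> fconn S \<and> arity S h \<ge> 2)"
| "is_srr S _ = False"

text \<open>Here \<open>p\<close> lists the nodes of a branch from the root downwards, without the leaf: leaves
  (variables, constants, nullary connectives) are not required to be PIA or Skeleton nodes.\<close>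

definition good_branch :: "'c signature \<Rightarrow> (('c, 'v) strm \<times> nat) list \<Rightarrow> bool" where
  "good_branch S p \<longleftrightarrow> (\<exists>ps qs. map fst p = ps @ qs \<and>
     (\<forall>x \<in> set ps. is_skeleton S x) \<and> (\<forall>x \<in> set qs. is_pia S x))"


section \<open>Analytic inductive and transferable inequalities\<close>

fun critical :: "('v \<Rightarrow> variance) \<Rightarrow> ('c, 'v) strm \<Rightarrow> bool" where
  "critical \<epsilon> (Plus, Var p) = (\<epsilon> p = One)"
| "critical \<epsilon> (Minus, Var p) = (\<epsilon> p = Dual)"
| "critical \<epsilon> _ = False"

definition agrees :: "'c signature \<Rightarrow> ('v \<Rightarrow> variance) \<Rightarrow> ('c, 'v) strm \<Rightarrow> bool" where
  "agrees S \<epsilon> x \<longleftrightarrow> (\<forall>p z. path S x p z \<and> is_Var (snd z) \<longrightarrow> critical \<epsilon> z)"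

definition inductive_tree ::
  "'c signature \<Rightarrow> ('v \<Rightarrow> 'v \<Rightarrow> bool) \<Rightarrow> ('v \<Rightarrow> variance) \<Rightarrow> ('c, 'v) strm \<Rightarrow> bool" where
  "inductive_tree S \<Omega> \<epsilon> x \<longleftrightarrow>
     (\<forall>p z q. path S x p z \<and> snd z = Var q \<and> critical \<epsilon> z \<longrightarrow>
        good_branch S p \<and>
        (\<forall>(y, i) \<in> set p. is_srr S y \<longrightarrow>
           (\<forall>j < length (children S y). j \<noteq> i \<longrightarrow>
              agrees S (opp \<circ> \<epsilon>) (children S y ! j) \<and>
              (\<forall>r \<in> vars (snd (children S y ! j)). \<Omega> r q))))"

definition analytic_inductive_tree ::
  "'c signature \<Rightarrow> ('v \<Rightarrow> 'v \<Rightarrow> bool) \<Rightarrow> ('v \<Rightarrow> variance) \<Rightarrow> ('c, 'v) strm \<Rightarrow> bool" where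
  "analytic_inductive_tree S \<Omega> \<epsilon> x \<longleftrightarrow> inductive_tree S \<Omega> \<epsilon> x \<and>
     (\<forall>p y. path S x p y \<and> is_leaf S y \<longrightarrow> good_branch S p)"

definition analytic_inductive ::
  "'c signature \<Rightarrow> ('v \<Rightarrow> 'v \<Rightarrow> bool) \<Rightarrow> ('v \<Rightarrow> variance) \<Rightarrow>
   ('c, 'v) trm \<Rightarrow> ('c, 'v) trm \<Rightarrow> bool" where
  "analytic_inductive S \<Omega> \<epsilon> s t \<longleftrightarrow>
     analytic_inductive_tree S \<Omega> \<epsilon> (Plus, s) \<and> analytic_inductive_tree S \<Omega> \<epsilon> (Minus, t)"

text \<open>\<open>p\<close> is the path from the root of \<open>x\<close> to the subtree \<open>y\<close>, so its last node is the
  parent of \<open>y\<close>.\<close>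

definition maximal_pia_subterm ::
  "'c signature \<Rightarrow> ('c, 'v) strm \<Rightarrow> ('c, 'v) strm \<Rightarrow> bool" where
  "maximal_pia_subterm S x y \<longleftrightarrow>
     (\<exists>p. path S x p y \<and> (p = [] \<or> is_skeleton S (fst (last p)))) \<and>
     \<not> is_skeleton S y \<and>
     (\<forall>p z. path S y p z \<and> \<not> is_leaf S z \<longrightarrow> is_pia S z)"

definition transferable_tree ::
  "'c signature \<Rightarrow> ('v \<Rightarrow> variance) \<Rightarrow> ('c, 'v) strm \<Rightarrow> bool" where
  "transferable_tree S \<epsilon> x \<longleftrightarrow>
     (\<forall>y. maximal_pia_subterm S x y \<and> (\<forall>p z. path S y p z \<and> is_leaf S z \<longrightarrow> \<not> critical \<epsilon> z) \<longrightarrow>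
        vars (snd y) = {} \<or>
        (\<exists>q. y = (Plus, Var q) \<and> \<epsilon> q = Dual) \<or>
        (\<exists>p. y = (Minus, Var p) \<and> \<epsilon> p = One))"

definition transferable ::
  "'c signature \<Rightarrow> ('v \<Rightarrow> variance) \<Rightarrow> ('c, 'v) trm \<Rightarrow> ('c, 'v) trm \<Rightarrow> bool" where
  "transferable S \<epsilon> s t \<longleftrightarrow>
     transferable_tree S \<epsilon> (Plus, s) \<and> transferable_tree S \<epsilon> (Minus, t)"

end

theory Submission
  imports Defs
begin

text \<open>Elements of the canonical extension are joins of closed and meets of open elements, and the
  Skeleton connectives preserve all joins in their sign. Hence \<open>\<phi> \<le> \<psi>\<close> holds at an assignment \<open>v\<close> as
  soon as \<open>c \<le> d\<close> for all approximants \<open>c\<close> of \<open>\<phi>\<close> and \<open>d\<close> of \<open>\<psi>\<close>, where an approximant arises by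
  replacing each maximal PIA-subterm by a closed (or open, according to the sign) element bounding
  its value. Each pair \<open>c, d\<close> involves finitely many such bounds, and it suffices to find an
  assignment into the lattice itself that satisfies all of them, since there the inequality holds.
  As in Ackermann's lemma, residuation along the critical branches shows that \<open>v\<close> may be lowered in
  the sense of \<open>\<epsilon>\<close> to closed or open values, treating the \<open>\<Omega>\<close>-smallest variables first. Compactness
  then allows these values to be raised to elements of the lattice, now treating the
  \<open>\<Omega>\<close>-largest variables first, so that the side arguments of a critical branch are touched only
  when its own variable has become clopen.\<close>

section \<open>Signed orders\<close>

abbreviation neg :: "sign \<Rightarrow> sign" where
  "neg \<equiv> child_sign Dual"

text \<open>A sign selects the lattice order or its dual. Statements carry the sign as a parameter,
  so each argument covers joins and meets, closed and open elements, and both families of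
  connectives at once.\<close>

primrec sle :: "sign \<Rightarrow> 'a::order \<Rightarrow> 'a \<Rightarrow> bool" where
  "sle Plus x y = (x \<le> y)"
| "sle Minus x y = (y \<le> x)"

primrec smeet :: "sign \<Rightarrow> 'a::lattice \<Rightarrow> 'a \<Rightarrow> 'a" where
  "smeet Plus x y = inf x y"
| "smeet Minus x y = sup x y"

primrec stop :: "sign \<Rightarrow> 'a::bounded_lattice" where
  "stop Plus = top"
| "stop Minus = bot"

primrec sInf :: "sign \<Rightarrow> 'a::complete_lattice set \<Rightarrow> 'a" where
  "sInf Plus X = Inf X"
| "sInf Minus X = Sup X"

abbreviation sjoin :: "sign \<Rightarrow> 'a::lattice \<Rightarrow> 'a \<Rightarrow> 'a" where
  "sjoin \<sigma> \<equiv> smeet (neg \<sigma>)"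

abbreviation sbot :: "sign \<Rightarrow> 'a::bounded_lattice" where
  "sbot \<sigma> \<equiv> stop (neg \<sigma>)"

abbreviation sSup :: "sign \<Rightarrow> 'a::complete_lattice set \<Rightarrow> 'a" where
  "sSup \<sigma> \<equiv> sInf (neg \<sigma>)"

lemma neg_neg [simp]: "neg (neg \<sigma>) = \<sigma>"
  by (cases \<sigma>) auto

lemma child_sign_neg: "child_sign \<eta> (neg \<sigma>) = neg (child_sign \<eta> \<sigma>)"
  by (cases \<sigma>; cases \<eta>) auto

lemma neg_neq [simp]: "neg \<sigma> \<noteq> \<sigma>" "\<sigma> \<noteq> neg \<sigma>"
  by (cases \<sigma>; simp)+

lemma neq_sign_iff: "\<sigma> \<noteq> \<tau> \<longleftrightarrow> \<sigma> = neg \<tau>"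
  by (cases \<sigma>; cases \<tau>) auto

lemma sle_neg [simp]: "sle (neg \<sigma>) x y \<longleftrightarrow> sle \<sigma> y x"
  by (cases \<sigma>) auto

lemma sle_refl [simp]: "sle \<sigma> x x"
  by (cases \<sigma>) auto

lemma sle_trans [trans]: "sle \<sigma> x y \<Longrightarrow> sle \<sigma> y z \<Longrightarrow> sle \<sigma> x z"
  by (cases \<sigma>) auto

lemma sle_antisym: "sle \<sigma> x y \<Longrightarrow> sle \<sigma> y x \<Longrightarrow> x = y"
  by (cases \<sigma>) auto

lemma sle_smeet [simp]: "sle \<sigma> x (smeet \<sigma> y z) \<longleftrightarrow> sle \<sigma> x y \<and> sle \<sigma> x z"
  by (cases \<sigma>) auto

lemma smeet_sle [simp]: "sle \<sigma> (smeet \<sigma> x y) x" "sle \<sigma> (smeet \<sigma> x y) y"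
  by (cases \<sigma>; simp)+

lemma sjoin_sle [simp]: "sle \<sigma> (sjoin \<sigma> x y) z \<longleftrightarrow> sle \<sigma> x z \<and> sle \<sigma> y z"
  by (cases \<sigma>) auto

lemma sle_sjoin [simp]: "sle \<sigma> x (sjoin \<sigma> x y)" "sle \<sigma> y (sjoin \<sigma> x y)"
  by (cases \<sigma>; simp)+

lemma sle_stop [simp]: "sle \<sigma> x (stop \<sigma>)"
  by (cases \<sigma>) auto

lemma sbot_sle [simp]: "sle \<sigma> (sbot \<sigma>) x"
  by (cases \<sigma>) auto

lemma sInf_lower: "x \<in> X \<Longrightarrow> sle \<sigma> (sInf \<sigma> X) x"
  by (cases \<sigma>) (auto simp: Inf_lower Sup_upper)

lemma sle_sInf_iff: "sle \<sigma> x (sInf \<sigma> X) \<longleftrightarrow> (\<forall>y\<in>X. sle \<sigma> x y)"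
  by (cases \<sigma>) (auto simp: le_Inf_iff Sup_le_iff)

lemma sSup_upper: "x \<in> X \<Longrightarrow> sle \<sigma> x (sSup \<sigma> X)"
  using sInf_lower[of x X "neg \<sigma>"] by simp

lemma sSup_sle_iff: "sle \<sigma> (sSup \<sigma> X) x \<longleftrightarrow> (\<forall>y\<in>X. sle \<sigma> y x)"
  using sle_sInf_iff[of "neg \<sigma>" x X] by simp

text \<open>Compactness delivers finite subfamilies; in a directed set a single member can then
  stand in for them. The set \<open>D\<close> must be nonempty to settle an empty subfamily.\<close>

lemma sle_lower_bound_finite:
  assumes "finite X" "X \<subseteq> D" "D \<noteq> {}"
    and "\<And>x y. x \<in> D \<Longrightarrow> y \<in> D \<Longrightarrow> \<exists>z\<in>D. sle \<sigma> z x \<and> sle \<sigma> z y"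
  shows "\<exists>z\<in>D. \<forall>x\<in>X. sle \<sigma> z x"
  using assms(1,2)
proof (induction X rule: finite_induct)
  case empty
  then show ?case using \<open>D \<noteq> {}\<close> by auto
next
  case (insert a X)
  then obtain z where "z \<in> D" "\<forall>x\<in>X. sle \<sigma> z x" by auto
  moreover obtain y where "y \<in> D" "sle \<sigma> y z" "sle \<sigma> y a"
    using assms(4) insert.prems \<open>z \<in> D\<close> by blast
  ultimately show ?case by (metis insert_iff sle_trans)
qed


section \<open>Closed and open elements\<close>

locale canext =
  fixes e :: "'a::bounded_lattice \<Rightarrow> 'd::complete_lattice"
  assumes canonical_extension: "canonical_extension e"
begin

text \<open>Open elements are the closed elements of the order dual, so
  \<open>cl (neg \<sigma>)\<close> is always the kind opposite to
  \<open>cl \<sigma>\<close>.\<close>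

primrec cl :: "sign \<Rightarrow> 'd set" where
  "cl Plus = closed_elems e"
| "cl Minus = open_elems e"

lemma embedding:
  "inj e" "e bot = bot" "e top = top" "e (inf x y) = inf (e x) (e y)" "e (sup x y) = sup (e x) (e y)"
  using canonical_extension
  unfolding canonical_extension_def bounded_lattice_embedding_def by blast+

lemma e_smeet: "e (smeet \<sigma> x y) = smeet \<sigma> (e x) (e y)"
  by (cases \<sigma>) (simp_all add: embedding)

lemma e_stop: "e (stop \<sigma>) = stop \<sigma>"
  by (cases \<sigma>) (simp_all add: embedding)

lemma e_sle_iff [simp]: "sle \<sigma> (e x) (e y) \<longleftrightarrow> sle \<sigma> x y"
proof -
  have "e x \<le> e y \<longleftrightarrow> x \<le> y" for x y
    using embedding(1,4) by (metis inf.orderE inf.orderI injD)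
  then show ?thesis by (cases \<sigma>) auto
qed

lemma cl_eq: "cl \<sigma> = {sInf \<sigma> (e ` X) | X. True}"
  by (cases \<sigma>) (auto simp: closed_elems_def open_elems_def)

lemma sInf_in_cl: "sInf \<sigma> (e ` X) \<in> cl \<sigma>"
  by (auto simp: cl_eq)

lemma e_in_cl [simp]: "e a \<in> cl \<sigma>"
proof -
  have "sInf \<sigma> (e ` {a}) = e a" by (cases \<sigma>) auto
  then show ?thesis using sInf_in_cl[of \<sigma> "{a}"] by simp
qed

lemma stop_in_cl [simp]: "stop \<tau> \<in> cl \<sigma>"
  using e_in_cl[of "stop \<tau>" \<sigma>] by (simp add: e_stop)

text \<open>Density writes \<open>z\<close> as a \<open>\<sigma>\<close>-meet of elements of
  \<open>cl (neg \<sigma>)\<close>, so testing against those above \<open>z\<close>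
  suffices.\<close>

lemma dense_sle_open:
  assumes "\<And>y. y \<in> cl (neg \<sigma>) \<Longrightarrow> sle \<sigma> z y \<Longrightarrow> sle \<sigma> x y"
  shows "sle \<sigma> x z"
proof -
  obtain Y where "Y \<subseteq> cl (neg \<sigma>)" "z = sInf \<sigma> Y"
  proof -
    have "(\<exists>X \<subseteq> closed_elems e. z = Sup X) \<and> (\<exists>Y \<subseteq> open_elems e. z = Inf Y)"
      using canonical_extension unfolding canonical_extension_def dense_embedding_def by blast
    then show thesis using that by (cases \<sigma>) auto
  qed
  then have "sle \<sigma> x y" if "y \<in> Y" for y
    using that assms sInf_lower[of y Y \<sigma>] by blast
  then show ?thesis unfolding \<open>z = sInf \<sigma> Y\<close> sle_sInf_iff by blast
qed

lemma dense_closed_sle: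
  assumes "\<And>k. k \<in> cl \<sigma> \<Longrightarrow> sle \<sigma> k x \<Longrightarrow> sle \<sigma> k z"
  shows "sle \<sigma> x z"
  using dense_sle_open[of "neg \<sigma>" x z] assms by auto

text \<open>Compactness reduces the meet to finitely many members of \<open>X\<close>, and
  directedness reduces these to one. On the other side, the finite join only has to be enlarged back
  to \<open>y\<close>.\<close>

lemma directed_compact:
  assumes X: "X \<noteq> {}" "\<And>x y. x \<in> X \<Longrightarrow> y \<in> X \<Longrightarrow> \<exists>z\<in>X. sle \<sigma> z x \<and> sle \<sigma> z y"
    and y: "y \<in> cl (neg \<sigma>)" and le: "sle \<sigma> (sInf \<sigma> (e ` X)) y"
  shows "\<exists>x\<in>X. sle \<sigma> (e x) y"
proof -
  obtain Y where Y: "y = sSup \<sigma> (e ` Y)" using y by (auto simp: cl_eq)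
  obtain X' Y' where fin: "finite X'" "X' \<subseteq> X" "Y' \<subseteq> Y"
    and le': "sle \<sigma> (sInf \<sigma> (e ` X')) (sSup \<sigma> (e ` Y'))"
  proof (cases \<sigma>)
    case Plus
    then have "Inf (e ` X) \<le> Sup (e ` Y)" using le Y by simp
    then obtain X' Y' where "finite X'" "X' \<subseteq> X" "Y' \<subseteq> Y" "Inf (e ` X') \<le> Sup (e ` Y')"
      using canonical_extension unfolding canonical_extension_def compact_embedding_def by blast
    then show ?thesis using that Plus by simp
  next
    case Minus
    \<comment> \<open>In the dual order meets and joins trade places, so now \<open>Y\<close>
      supplies the meet in the compactness condition.\<close>
    then have "Inf (e ` Y) \<le> Sup (e ` X)" using le Y by simp
    then obtain X' Y' where "finite X'" "X' \<subseteq> X" "Y' \<subseteq> Y" "Inf (e ` Y') \<le> Sup (e ` X')"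
      using canonical_extension unfolding canonical_extension_def compact_embedding_def by blast
    then show ?thesis using that Minus by simp
  qed
  obtain x where "x \<in> X" "\<forall>x'\<in>X'. sle \<sigma> x x'"
    using sle_lower_bound_finite[OF fin(1,2) X] by blast
  then have "sle \<sigma> (e x) (sInf \<sigma> (e ` X'))" by (auto simp: sle_sInf_iff)
  moreover have "sle \<sigma> (sSup \<sigma> (e ` Y')) y"
    using fin(3) unfolding Y sSup_sle_iff by (auto intro: sSup_upper)
  ultimately show ?thesis using le' \<open>x \<in> X\<close> by (meson sle_trans)
qed

text \<open>Any generating family of \<open>k\<close> consists of lattice elements above
  \<open>k\<close>. Passing to all of them gives a family closed under binary meets, which
  compactness can use.\<close>

lemma cl_sInf_above:
  assumes "k \<in> cl \<sigma>"
  shows "sInf \<sigma> (e ` {a. sle \<sigma> k (e a)}) = k"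
proof (rule sle_antisym[of \<sigma>])
  obtain X where "k = sInf \<sigma> (e ` X)" using assms by (auto simp: cl_eq)
  then show "sle \<sigma> (sInf \<sigma> (e ` {a. sle \<sigma> k (e a)})) k"
    by (simp add: sle_sInf_iff sInf_lower)
qed (auto simp: sle_sInf_iff)

lemma interpolate:
  assumes "k \<in> cl \<sigma>" "y \<in> cl (neg \<sigma>)" "sle \<sigma> k y"
  shows "\<exists>a. sle \<sigma> k (e a) \<and> sle \<sigma> (e a) y"
proof -
  let ?X = "{a. sle \<sigma> k (e a)}"
  have "stop \<sigma> \<in> ?X" by (simp add: e_stop)
  then have "?X \<noteq> {}" by blast
  moreover have "\<exists>z\<in>?X. sle \<sigma> z a \<and> sle \<sigma> z b" if "a \<in> ?X" "b \<in> ?X" for a b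
    by (rule bexI[of _ "smeet \<sigma> a b"]) (use that in \<open>simp_all add: e_smeet\<close>)
  moreover have "sle \<sigma> (sInf \<sigma> (e ` ?X)) y"
    using assms by (simp add: cl_sInf_above)
  ultimately have "\<exists>a\<in>?X. sle \<sigma> (e a) y"
    using assms(2) by (intro directed_compact[of ?X \<sigma> y])
  then show ?thesis by simp
qed

text \<open>The candidate is the meet of all lattice elements above the join. Tested against an open
  \<open>y\<close> above the join, it lies below \<open>y\<close>: interpolate between
  \<open>k\<close> and \<open>y\<close> and between \<open>l\<close> and \<open>y\<close>, then join
  the two interpolants in the lattice.\<close>

lemma sjoin_in_cl:
  assumes k: "k \<in> cl \<sigma>" and l: "l \<in> cl \<sigma>"
  shows "sjoin \<sigma> k l \<in> cl \<sigma>"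
proof -
  let ?m = "sInf \<sigma> (e ` {a. sle \<sigma> (sjoin \<sigma> k l) (e a)})"
  have "sle \<sigma> ?m (sjoin \<sigma> k l)"
  proof (rule dense_sle_open)
    fix y assume y: "y \<in> cl (neg \<sigma>)" "sle \<sigma> (sjoin \<sigma> k l) y"
    then obtain a b where "sle \<sigma> k (e a)" "sle \<sigma> (e a) y" "sle \<sigma> l (e b)" "sle \<sigma> (e b) y"
      using interpolate[OF k] interpolate[OF l] unfolding sjoin_sle by blast
    then have "sle \<sigma> (sjoin \<sigma> k l) (e (sjoin \<sigma> a b))" "sle \<sigma> (e (sjoin \<sigma> a b)) y"
      by (auto simp: e_smeet intro: sle_trans)
    then show "sle \<sigma> ?m y" by (auto intro: sle_trans[OF sInf_lower])
  qed
  then have "?m = sjoin \<sigma> k l" by (auto intro: sle_antisym simp: sle_sInf_iff)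
  then show ?thesis by (metis sInf_in_cl)
qed

end


section \<open>Extensions of normal operations\<close>

text \<open>A join-preserving \<open>f\<close> is an operation with \<open>\<theta> = Plus\<close> and a meet-preserving \<open>g\<close> is one
  with \<open>\<theta> = Minus\<close>; \<open>\<eta>s ! i\<close> is the sign of the order in which the \<open>i\<close>-th argument is read, so
  that in either case joins with respect to \<open>\<eta>s ! i\<close> become joins with respect to \<open>\<theta>\<close>.\<close>

locale canext_op = canext e for e :: "'a::bounded_lattice \<Rightarrow> 'd::complete_lattice" +
  fixes \<theta> :: sign and \<eta>s :: "sign list" and f :: "'a list \<Rightarrow> 'a"
  assumes f_sbot: "length as = length \<eta>s \<Longrightarrow> i < length \<eta>s \<Longrightarrow> f (as[i := sbot (\<eta>s ! i)]) = sbot \<theta>"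
    and f_sjoin: "length as = length \<eta>s \<Longrightarrow> i < length \<eta>s \<Longrightarrow>
      f (as[i := sjoin (\<eta>s ! i) x y]) = sjoin \<theta> (f (as[i := x])) (f (as[i := y]))"
begin

definition les :: "'b::order list \<Rightarrow> 'b list \<Rightarrow> bool" where
  "les xs ys \<longleftrightarrow> length xs = length \<eta>s \<and> length ys = length \<eta>s \<and>
     (\<forall>i < length \<eta>s. sle (\<eta>s ! i) (xs ! i) (ys ! i))"

definition cls :: "'d list set" where
  "cls = {ks. length ks = length \<eta>s \<and> (\<forall>i < length \<eta>s. ks ! i \<in> cl (\<eta>s ! i))}"

text \<open>For \<open>\<theta> = Plus\<close> this and \<open>ext\<close> are the sigma-extension
  on closed and on arbitrary tuples; for \<open>\<theta> = Minus\<close> they are the pi-extension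
  on open and on arbitrary tuples.\<close>

definition ext_closed :: "'d list \<Rightarrow> 'd" where
  "ext_closed ks = sInf \<theta> {e (f as) | as. les ks (map e as)}"

definition ext :: "'d list \<Rightarrow> 'd" where
  "ext us = sSup \<theta> {ext_closed ks | ks. ks \<in> cls \<and> les ks us}"

lemma les_refl: "length xs = length \<eta>s \<Longrightarrow> les xs xs"
  by (simp add: les_def)

lemma les_trans: "les xs ys \<Longrightarrow> les ys zs \<Longrightarrow> les xs zs"
  unfolding les_def using sle_trans by blast

lemma les_update:
  "les xs ys \<Longrightarrow> i < length \<eta>s \<Longrightarrow> sle (\<eta>s ! i) x y \<Longrightarrow> les (xs[i := x]) (ys[i := y])"
  unfolding les_def by (simp add: nth_list_update)

lemma les_update_nth:
  assumes "les (ks[i := k]) ys" "i < length \<eta>s"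
  shows "les (ks[i := ys ! i]) ys"
  using assms unfolding les_def by (auto simp: nth_list_update)

lemma les_map_e: "les (map e as) (map e bs) \<longleftrightarrow> les as bs"
  unfolding les_def by auto

lemma f_mono_coord:
  assumes "length as = length \<eta>s" "i < length \<eta>s" "sle (\<eta>s ! i) x y"
  shows "sle \<theta> (f (as[i := x])) (f (as[i := y]))"
proof -
  have "sjoin (\<eta>s ! i) x y = y" using assms(3) by (auto intro: sle_antisym[of "\<eta>s ! i"])
  then show ?thesis using f_sjoin[OF assms(1,2), of x y] by (metis sle_sjoin(1))
qed

lemma f_mono:
  assumes "les as bs"
  shows "sle \<theta> (f as) (f bs)"
proof -
  have len: "length as = length \<eta>s" "length bs = length \<eta>s"
    and le: "\<And>i. i < length \<eta>s \<Longrightarrow> sle (\<eta>s ! i) (as ! i) (bs ! i)"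
    using assms by (auto simp: les_def)
  \<comment> \<open>The hybrid tuple has its first \<open>m\<close> entries from \<open>bs\<close>
    and the rest from \<open>as\<close>; going from \<open>m\<close> to \<open>Suc m\<close> changes
    only coordinate \<open>m\<close>.\<close>
  have "sle \<theta> (f as) (f (take m bs @ drop m as))" if "m \<le> length \<eta>s" for m
    using that
  proof (induction m)
    case (Suc m)
    let ?c = "take m bs @ drop m as"
    have c: "length ?c = length \<eta>s" and m: "m < length \<eta>s" using len Suc.prems by auto
    have "?c[m := as ! m] = ?c"
      using len m by (simp add: list_update_append Cons_nth_drop_Suc[symmetric])
    moreover have "?c[m := bs ! m] = take (Suc m) bs @ drop (Suc m) as"
      using len m by (simp add: list_update_append take_Suc_conv_app_nth Cons_nth_drop_Suc[symmetric])
    ultimately have "sle \<theta> (f ?c) (f (take (Suc m) bs @ drop (Suc m) as))"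
      using f_mono_coord[OF c m le[OF m]] by simp
    then show ?case using Suc.IH m sle_trans by (metis less_imp_le)
  qed simp
  from this[of "length \<eta>s"] show ?thesis using len by simp
qed

definition meets :: "'a list \<Rightarrow> 'a list \<Rightarrow> 'a list" where
  "meets as bs = map (\<lambda>i. smeet (\<eta>s ! i) (as ! i) (bs ! i)) [0..<length \<eta>s]"

lemma les_meets:
  assumes "length as = length \<eta>s" "length bs = length \<eta>s"
  shows "les (meets as bs) as" "les (meets as bs) bs"
    "les ks (map e (meets as bs)) \<longleftrightarrow> les ks (map e as) \<and> les ks (map e bs)"
  using assms by (auto simp: les_def meets_def e_smeet)

lemma les_stop: "length us = length \<eta>s \<Longrightarrow> les us (map e (map stop \<eta>s))"
  by (simp add: les_def e_stop)

section \<open>The extension on closed and on lattice tuples\<close>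

lemma ext_closed_mono: "les ks ls \<Longrightarrow> sle \<theta> (ext_closed ks) (ext_closed ls)"
  unfolding ext_closed_def sle_sInf_iff by (auto intro!: sInf_lower intro: les_trans)

lemma ext_eq_ext_closed:
  assumes "ks \<in> cls"
  shows "ext ks = ext_closed ks"
proof (rule sle_antisym[of \<theta>])
  show "sle \<theta> (ext ks) (ext_closed ks)"
    unfolding ext_def sSup_sle_iff by (auto intro: ext_closed_mono)
  show "sle \<theta> (ext_closed ks) (ext ks)"
    unfolding ext_def using assms by (auto intro!: sSup_upper les_refl simp: cls_def)
qed

lemma ext_mono: "les us us' \<Longrightarrow> sle \<theta> (ext us) (ext us')"
  unfolding ext_def sSup_sle_iff by (auto intro!: sSup_upper intro: les_trans)

lemma ext_cls: "ks \<in> cls \<Longrightarrow> ext ks \<in> cl \<theta>"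
proof -
  assume "ks \<in> cls"
  moreover have "ext_closed ks = sInf \<theta> (e ` {f as | as. les ks (map e as)})"
    unfolding ext_closed_def by (rule arg_cong[of _ _ "sInf \<theta>"]) auto
  ultimately show ?thesis using sInf_in_cl ext_eq_ext_closed by simp
qed

lemma ext_e:
  assumes "length as = length \<eta>s"
  shows "ext (map e as) = e (f as)"
proof -
  have "map e as \<in> cls" using assms by (auto simp: cls_def)
  moreover have "ext_closed (map e as) = e (f as)"
    unfolding ext_closed_def
  proof (rule sle_antisym[of \<theta>])
    show "sle \<theta> (e (f as)) (sInf \<theta> {e (f bs) |bs. les (map e as) (map e bs)})"
      unfolding sle_sInf_iff using f_mono by (auto simp: les_map_e)
  qed (use assms in \<open>auto intro!: sInf_lower les_refl\<close>)
  ultimately show ?thesis by (simp add: ext_eq_ext_closed)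
qed

text \<open>The values of \<open>f\<close> at lattice tuples above \<open>ks\<close> are directed,
  because such tuples are closed under coordinatewise meets and \<open>f\<close> is monotone. Hence
  one tuple already brings the value below \<open>y\<close>.\<close>

lemma ext_compact:
  assumes "ks \<in> cls" "y \<in> cl (neg \<theta>)" "sle \<theta> (ext ks) y"
  shows "\<exists>as. les ks (map e as) \<and> sle \<theta> (e (f as)) y"
proof -
  let ?X = "{f as | as. les ks (map e as)}"
  have len: "length ks = length \<eta>s" using assms(1) by (simp add: cls_def)
  have "\<exists>x\<in>?X. sle \<theta> (e x) y"
  proof (rule directed_compact)
    show "?X \<noteq> {}" using les_stop[OF len] by blast
    show "\<exists>z\<in>?X. sle \<theta> z x \<and> sle \<theta> z x'" if xx': "x \<in> ?X" "x' \<in> ?X" for x x'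
    proof -
      obtain as bs where as: "x = f as" "les ks (map e as)" and bs: "x' = f bs" "les ks (map e bs)"
        using xx' by auto
      then have "length as = length \<eta>s" "length bs = length \<eta>s" by (auto simp: les_def)
      note m = les_meets[OF this]
      show ?thesis
      proof (intro bexI conjI)
        show "sle \<theta> (f (meets as bs)) x" "sle \<theta> (f (meets as bs)) x'"
          using as bs m f_mono by auto
        show "f (meets as bs) \<in> ?X" using as bs m by auto
      qed
    qed
    have "e ` ?X = {e (f as) | as. les ks (map e as)}" by auto
    then show "sle \<theta> (sInf \<theta> (e ` ?X)) y"
      using assms ext_eq_ext_closed by (simp add: ext_closed_def)
  qed (fact assms)
  then show ?thesis by auto
qed

text \<open>The set \<open>B\<close> below plays the role of a residual: its join is the largest \<open>i\<close>-th argument for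
  which the value stays below \<open>y\<close>.\<close>

lemma ext_sSup:
  assumes i: "i < length \<eta>s" and len: "length us = length \<eta>s"
  shows "sle \<theta> (ext (us[i := sSup (\<eta>s ! i) U])) (sSup \<theta> {ext (us[i := u]) | u. u \<in> U})"
    (is "sle \<theta> _ ?z")
proof (rule dense_sle_open)
  fix y assume y: "y \<in> cl (neg \<theta>)" and zy: "sle \<theta> ?z y"
  show "sle \<theta> (ext (us[i := sSup (\<eta>s ! i) U])) y"
    unfolding ext_def sSup_sle_iff
  proof clarify
    fix ks assume ks: "ks \<in> cls" and le: "les ks (us[i := sSup (\<eta>s ! i) U])"
    define B where "B = {b. \<exists>as. les (ks[i := e b]) (map e as) \<and> as ! i = b \<and> sle \<theta> (e (f as)) y}"
    have B_I: "b \<in> B"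
      if "les (ks[i := e b]) (map e as)" "as ! i = b" "sle \<theta> (e (f as)) y" for as b
      using that unfolding B_def by blast
    have lk: "length ks = length \<eta>s" using ks by (simp add: cls_def)
    have upd: "les ks (map e (as[i := b]))" 
      if "les (ks[i := e c]) (map e as)" "sle (\<eta>s ! i) (ks ! i) (e b)" for as b c
      using that i lk unfolding les_def by (auto simp: nth_list_update)
    \<comment> \<open>By density it suffices to bound a closed \<open>k\<close> below some
      \<open>u\<close> in \<open>U\<close>. The tuple with \<open>k\<close> at position
      \<open>i\<close> is closed and has value below \<open>y\<close>, so compactness yields a
      lattice tuple whose \<open>i\<close>-th entry lies in \<open>B\<close> and above
      \<open>k\<close>.\<close>
    have "sle (\<eta>s ! i) (sSup (\<eta>s ! i) U) (sSup (\<eta>s ! i) (e ` B))"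
      unfolding sSup_sle_iff
    proof
      fix u assume u: "u \<in> U"
      show "sle (\<eta>s ! i) u (sSup (\<eta>s ! i) (e ` B))"
      proof (rule dense_closed_sle)
        fix k assume k: "k \<in> cl (\<eta>s ! i)" "sle (\<eta>s ! i) k u"
        have c: "ks[i := k] \<in> cls" using ks k i by (auto simp: cls_def nth_list_update)
        have "les (ks[i := k]) (us[i := u])"
          using les_update[OF le i k(2)] by simp
        then have "sle \<theta> (ext (ks[i := k])) (ext (us[i := u]))" by (rule ext_mono)
        also have "sle \<theta> \<dots> ?z" using u by (auto intro: sSup_upper)
        also note zy
        finally obtain as where as: "les (ks[i := k]) (map e as)" "sle \<theta> (e (f as)) y"
          using ext_compact[OF c y] by auto
        have la: "length as = length \<eta>s" using as by (simp add: les_def)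
        have "les (ks[i := e (as ! i)]) (map e as)"
          using les_update_nth[OF as(1) i] la i by simp
        then have "as ! i \<in> B" using as(2) B_I by blast
        moreover have "sle (\<eta>s ! i) k (e (as ! i))"
          using as(1) i lk by (auto simp: les_def dest: spec[of _ i])
        ultimately show "sle (\<eta>s ! i) k (sSup (\<eta>s ! i) (e ` B))"
          by (meson imageI sSup_upper sle_trans)
      qed
    qed
    moreover have "sle (\<eta>s ! i) (ks ! i) (sSup (\<eta>s ! i) U)"
      using le i len by (auto simp: les_def dest: spec[of _ i])
    ultimately have kB: "sle (\<eta>s ! i) (ks ! i) (sSup (\<eta>s ! i) (e ` B))" by (meson sle_trans)
    \<comment> \<open>The closed \<open>ks ! i\<close> lies below the join of \<open>B\<close>, and
      \<open>B\<close> is directed upwards; compactness in the dual order puts it below a single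
      member.\<close>
    have "\<exists>b\<in>B. sle (neg (\<eta>s ! i)) (e b) (ks ! i)"
    proof (rule directed_compact)
      \<comment> \<open>With the empty join at position \<open>i\<close>, normality makes the value
        the bottom of \<open>\<theta>\<close>; the other entries can be taken as large as
        possible.\<close>
      let ?as = "(map stop \<eta>s)[i := sbot (\<eta>s ! i)]"
      have "les (ks[i := e (sbot (\<eta>s ! i))]) (map e ?as)"
        using les_update[OF les_stop[OF lk] i sle_refl] by (simp add: map_update)
      moreover have "sle \<theta> (e (f ?as)) y"
        using f_sbot[of "map stop \<eta>s" i] i by (simp add: e_stop)
      ultimately have "sbot (\<eta>s ! i) \<in> B" using B_I[of _ ?as] i by simp
      then show "B \<noteq> {}" by auto
      show "\<exists>z\<in>B. sle (neg (\<eta>s ! i)) z b \<and> sle (neg (\<eta>s ! i)) z c" if bc: "b \<in> B" "c \<in> B" for b c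
      proof -
        obtain as bs where as: "les (ks[i := e b]) (map e as)" "as ! i = b" "sle \<theta> (e (f as)) y"
          and bs: "les (ks[i := e c]) (map e bs)" "bs ! i = c" "sle \<theta> (e (f bs)) y"
          using bc unfolding B_def by auto
        have l: "length as = length \<eta>s" "length bs = length \<eta>s" using as bs by (auto simp: les_def)
        \<comment> \<open>Two witnesses combine by meeting all other coordinates and joining
          coordinate \<open>i\<close>; binary join preservation keeps the value below
          \<open>y\<close>.\<close>
        let ?j = "sjoin (\<eta>s ! i) b c" and ?m = "meets as bs"
        have lm: "length ?m = length \<eta>s" by (simp add: meets_def)
        have "les (?m[i := b]) as" "les (?m[i := c]) bs"
          using les_update[OF les_meets(1)[OF l] i sle_refl, of b]
            les_update[OF les_meets(2)[OF l] i sle_refl, of c] as(2) bs(2)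
          by auto
        then have "sle \<theta> (e (f (?m[i := b]))) y" "sle \<theta> (e (f (?m[i := c]))) y"
          using as(3) bs(3) f_mono by (meson e_sle_iff sle_trans)+
        then have "sle \<theta> (e (f (?m[i := ?j]))) y"
          using f_sjoin[OF lm i] by (simp add: e_smeet)
        moreover have "les (ks[i := e ?j]) (map e (?m[i := ?j]))"
          using as(1) bs(1) l lm lk unfolding les_def
          using i by (auto simp: nth_list_update e_smeet meets_def)
        ultimately have "?j \<in> B" using B_I[of ?j "?m[i := ?j]"] i lm by simp
        then show ?thesis by (intro bexI[of _ ?j]) auto
      qed
      show "ks ! i \<in> cl (neg (neg (\<eta>s ! i)))" using ks i by (simp add: cls_def)
      show "sle (neg (\<eta>s ! i)) (sSup (\<eta>s ! i) (e ` B)) (ks ! i)" using kB by simp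
    qed
    then obtain b as where b: "sle (\<eta>s ! i) (ks ! i) (e b)" "les (ks[i := e b]) (map e as)"
        "as ! i = b" "sle \<theta> (e (f as)) y"
      unfolding B_def by auto
    then have "les ks (map e as)" using upd[of b as b] by (metis list_update_id)
    then have "sle \<theta> (ext_closed ks) (e (f as))"
      unfolding ext_closed_def by (auto intro: sInf_lower)
    then show "sle \<theta> (ext_closed ks) y" using b(4) by (meson sle_trans)
  qed
qed

text \<open>Complete join preservation in each coordinate allows the coordinates to be expanded one
  after another, so a bound on the tuples of generators bounds the value.\<close>

lemma ext_join_generated:
  assumes us: "length us = length \<eta>s" "\<And>i. i < length \<eta>s \<Longrightarrow> sle (\<eta>s ! i) (us ! i) (sSup (\<eta>s ! i) (X i))"
    and le: "\<And>cs. length cs = length \<eta>s \<Longrightarrow> (\<And>i. i < length \<eta>s \<Longrightarrow> cs ! i \<in> X i) \<Longrightarrow> sle \<theta> (ext cs) z"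
  shows "sle \<theta> (ext us) z"
proof -
  \<comment> \<open>The first \<open>m\<close> coordinates still await replacement by generators;
    those from \<open>m\<close> on already are generators.\<close>
  have "sle \<theta> (ext us) z"
    if "m \<le> length \<eta>s" "length us = length \<eta>s" "\<And>i. i < m \<Longrightarrow> sle (\<eta>s ! i) (us ! i) (sSup (\<eta>s ! i) (X i))"
      "\<And>i. m \<le> i \<Longrightarrow> i < length \<eta>s \<Longrightarrow> us ! i \<in> X i" for us m
    using that
  proof (induction m arbitrary: us)
    case 0
    then show ?case using le by auto
  next
    case (Suc m)
    let ?s = "us[m := sSup (\<eta>s ! m) (X m)]"
    have m: "m < length \<eta>s" using Suc.prems by simp
    have "les us ?s"
      using les_update[OF les_refl[OF Suc.prems(2)] m Suc.prems(3)[of m]] by simp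
    then have "sle \<theta> (ext us) (ext ?s)" by (rule ext_mono)
    also have "sle \<theta> \<dots> (sSup \<theta> {ext (us[m := x]) | x. x \<in> X m})"
      using ext_sSup m Suc.prems(2) by blast
    also have "sle \<theta> \<dots> z"
      unfolding sSup_sle_iff
    proof clarify
      fix x assume x: "x \<in> X m"
      show "sle \<theta> (ext (us[m := x])) z"
        using Suc.prems m x by (intro Suc.IH) (auto simp: nth_list_update)
    qed
    finally show ?case .
  qed
  from this[of "length \<eta>s" us] show ?thesis using us by simp
qed

text \<open>The witness is the join of all lattice elements that keep the value below
  \<open>y\<close> when put at position \<open>i\<close>. Being such a join it is open, and
  \<open>ext_sSup\<close> keeps its value below \<open>y\<close>. That it dominates
  \<open>us ! i\<close> is compactness, for which the other coordinates have to be closed.\<close>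

lemma ext_residual:
  assumes i: "i < length \<eta>s" and len: "length us = length \<eta>s" and y: "y \<in> cl (neg \<theta>)"
    and us: "\<And>j. j < length \<eta>s \<Longrightarrow> j \<noteq> i \<Longrightarrow> us ! j \<in> cl (\<eta>s ! j)" and le: "sle \<theta> (ext us) y"
  shows "\<exists>x \<in> cl (neg (\<eta>s ! i)). sle (\<eta>s ! i) (us ! i) x \<and> sle \<theta> (ext (us[i := x])) y"
proof -
  define B where "B = {b. sle \<theta> (ext (us[i := e b])) y}"
  have "sle (\<eta>s ! i) (us ! i) (sSup (\<eta>s ! i) (e ` B))"
  proof (rule dense_closed_sle)
    fix k assume k: "k \<in> cl (\<eta>s ! i)" "sle (\<eta>s ! i) k (us ! i)"
    have c: "us[i := k] \<in> cls" using us k len i unfolding cls_def by (simp add: nth_list_update)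
    have "les (us[i := k]) us"
      using les_update[OF les_refl[OF len] i k(2)] by simp
    then have "sle \<theta> (ext (us[i := k])) y" using le by (meson ext_mono sle_trans)
    then obtain as where as: "les (us[i := k]) (map e as)" "sle \<theta> (e (f as)) y"
      using ext_compact[OF c y] by auto
    have la: "length as = length \<eta>s" using as by (simp add: les_def)
    have "les (us[i := e (as ! i)]) (map e as)"
      using les_update_nth[OF as(1) i] la i by simp
    then have "sle \<theta> (ext (us[i := e (as ! i)])) (e (f as))"
      using ext_mono ext_e[OF la] by metis
    then have "as ! i \<in> B" using as(2) unfolding B_def by (auto intro: sle_trans)
    moreover have "sle (\<eta>s ! i) k (e (as ! i))"
      using as(1) i len by (auto simp: les_def dest: spec[of _ i])
    ultimately show "sle (\<eta>s ! i) k (sSup (\<eta>s ! i) (e ` B))"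
      by (meson imageI sSup_upper sle_trans)
  qed
  moreover have "sle \<theta> (ext (us[i := sSup (\<eta>s ! i) (e ` B)])) y"
    using ext_sSup[OF i len, of "e ` B"]
    by (rule sle_trans) (auto simp: sSup_sle_iff B_def)
  ultimately show ?thesis using sInf_in_cl by blast
qed

end


section \<open>Signed generation trees\<close>

definition pia_tree :: "'c signature \<Rightarrow> ('c, 'v) strm \<Rightarrow> bool" where
  "pia_tree S x \<longleftrightarrow> (\<forall>p y. path S x p y \<and> \<not> is_leaf S y \<longrightarrow> is_pia S y)"

definition occurs :: "'c signature \<Rightarrow> ('c, 'v) strm \<Rightarrow> sign \<Rightarrow> 'v \<Rightarrow> bool" where
  "occurs S x \<sigma> q \<longleftrightarrow> (\<exists>p. path S x p (\<sigma>, Var q))"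

lemma path_iff:
  "path S x p y \<longleftrightarrow> p = [] \<and> y = x \<or>
     (\<exists>i q. p = (x, i) # q \<and> i < length (children S x) \<and> path S (children S x ! i) q y)"
  by (subst path.simps) auto

lemma path_append: "path S x p y \<Longrightarrow> path S y q z \<Longrightarrow> path S x (p @ q) z"
  by (induction rule: path.induct) (auto intro: path.intros)

lemma good_branch_tl: "good_branch S (a # p) \<Longrightarrow> good_branch S p"
  unfolding good_branch_def
proof (elim exE conjE)
  fix ps qs
  assume *: "map fst (a # p) = ps @ qs" "\<forall>x\<in>set ps. is_skeleton S x" "\<forall>x\<in>set qs. is_pia S x"
  show "\<exists>ps qs. map fst p = ps @ qs \<and> (\<forall>x\<in>set ps. is_skeleton S x) \<and> (\<forall>x\<in>set qs. is_pia S x)"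
  proof (cases ps)
    case Nil
    then show ?thesis using * by (intro exI[of _ "[]"] exI[of _ "tl qs"]) auto
  next
    case (Cons b ps')
    then show ?thesis using * by (intro exI[of _ ps'] exI[of _ qs]) auto
  qed
qed

lemma pia_tree_child:
  "pia_tree S x \<Longrightarrow> i < length (children S x) \<Longrightarrow> pia_tree S (children S x ! i)"
  unfolding pia_tree_def by (meson path_Cons)

lemma pia_tree_root: "pia_tree S x \<Longrightarrow> children S x \<noteq> [] \<Longrightarrow> is_pia S x"
  unfolding pia_tree_def is_leaf_def by (meson path_Nil)

lemma critical_Var: "critical \<epsilon> (\<sigma>, Var q) \<longleftrightarrow> \<sigma> = child_sign (\<epsilon> q) Plus"
  by (cases \<sigma>; cases "\<epsilon> q") auto

text \<open>The side condition at a single node of a critical branch, isolated so that paths can be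
  lengthened or shortened without unfolding it.\<close>

definition srr_condition ::
  "'c signature \<Rightarrow> ('v \<Rightarrow> 'v \<Rightarrow> bool) \<Rightarrow> ('v \<Rightarrow> variance) \<Rightarrow> 'v \<Rightarrow> ('c, 'v) strm \<Rightarrow> nat \<Rightarrow> bool"
  where
  "srr_condition S \<Omega> \<epsilon> q y i \<longleftrightarrow> (is_srr S y \<longrightarrow>
     (\<forall>j < length (children S y). j \<noteq> i \<longrightarrow>
        agrees S (opp \<circ> \<epsilon>) (children S y ! j) \<and> (\<forall>r \<in> vars (snd (children S y ! j)). \<Omega> r q)))"

lemma inductive_tree_iff:
  "inductive_tree S \<Omega> \<epsilon> x \<longleftrightarrow> (\<forall>p \<sigma> q. path S x p (\<sigma>, Var q) \<longrightarrow> \<sigma> = child_sign (\<epsilon> q) Plus \<longrightarrow>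
     good_branch S p \<and> (\<forall>a \<in> set p. srr_condition S \<Omega> \<epsilon> q (fst a) (snd a)))"
proof -
  have eq: "inductive_tree S \<Omega> \<epsilon> x \<longleftrightarrow> (\<forall>p z q. path S x p z \<and> snd z = Var q \<and> critical \<epsilon> z \<longrightarrow>
     good_branch S p \<and> (\<forall>a \<in> set p. srr_condition S \<Omega> \<epsilon> q (fst a) (snd a)))"
    unfolding inductive_tree_def srr_condition_def case_prod_unfold by (rule refl)
  show ?thesis unfolding eq split_paired_All fst_conv snd_conv 
    by (auto simp: critical_Var)
qed

lemma inductive_tree_child:
  assumes "inductive_tree S \<Omega> \<epsilon> x" "i < length (children S x)"
  shows "inductive_tree S \<Omega> \<epsilon> (children S x ! i)"
  unfolding inductive_tree_iff
proof (intro allI impI)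
  fix p \<sigma> q assume a: "path S (children S x ! i) p (\<sigma>, Var q)" "\<sigma> = child_sign (\<epsilon> q) Plus"
  then have "path S x ((x, i) # p) (\<sigma>, Var q)" using assms(2) by (simp add: path_Cons)
  with a(2) assms(1) have "good_branch S ((x, i) # p) \<and>
      (\<forall>a \<in> set ((x, i) # p). srr_condition S \<Omega> \<epsilon> q (fst a) (snd a))"
    unfolding inductive_tree_iff by blast
  then show "good_branch S p \<and> (\<forall>a \<in> set p. srr_condition S \<Omega> \<epsilon> q (fst a) (snd a))"
    by (auto dest: good_branch_tl)
qed

lemma inductive_tree_sibling:
  assumes "inductive_tree S \<Omega> \<epsilon> x" "is_srr S x"
    and i: "i < length (children S x)" "occurs S (children S x ! i) (child_sign (\<epsilon> q) Plus) q"
    and j: "j < length (children S x)" "j \<noteq> i"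
  shows "agrees S (opp \<circ> \<epsilon>) (children S x ! j)" "\<And>r. r \<in> vars (snd (children S x ! j)) \<Longrightarrow> \<Omega> r q"
proof -
  obtain p where "path S (children S x ! i) p (child_sign (\<epsilon> q) Plus, Var q)" using i(2) by (auto simp: occurs_def)
  then have "path S x ((x, i) # p) (child_sign (\<epsilon> q) Plus, Var q)" using i(1) by (simp add: path_Cons)
  with assms(1) have "\<forall>a \<in> set ((x, i) # p). srr_condition S \<Omega> \<epsilon> q (fst a) (snd a)"
    unfolding inductive_tree_iff by blast
  then have "srr_condition S \<Omega> \<epsilon> q x i" by simp
  then show "agrees S (opp \<circ> \<epsilon>) (children S x ! j)" "\<And>r. r \<in> vars (snd (children S x ! j)) \<Longrightarrow> \<Omega> r q"
    using assms(2) j unfolding srr_condition_def by blast+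
qed

lemma analytic_inductive_tree_child:
  assumes "analytic_inductive_tree S \<Omega> \<epsilon> x" "i < length (children S x)"
  shows "analytic_inductive_tree S \<Omega> \<epsilon> (children S x ! i)"
  using assms inductive_tree_child[of S \<Omega> \<epsilon> x i] unfolding analytic_inductive_tree_def
  by (metis good_branch_tl path_Cons)

text \<open>Goodness is assumed for branches that end in leaves; this places every node on such a
  branch.\<close>

lemma path_to_leaf: "\<exists>p y. path S (\<sigma>, t) p y \<and> is_leaf S y"
proof (induction t arbitrary: \<sigma>)
  case (Op h ts)
  show ?case
  proof (cases "children S (\<sigma>, Op h ts)")
    case Nil
    then show ?thesis by (meson is_leaf_def path_Nil)
  next
    case (Cons z zs)
    then have "z \<in> set (zip (map (\<lambda>\<eta>. child_sign \<eta> \<sigma>) (otype S h)) ts)" by simp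
    then have "snd z \<in> set ts" by (metis prod.collapse set_zip_rightD)
    then obtain p y where "path S z p y" "is_leaf S y" using Op by (metis prod.collapse)
    then have "path S (\<sigma>, Op h ts) (((\<sigma>, Op h ts), 0) # p) y" using Cons by (simp add: path_Cons)
    then show ?thesis using \<open>is_leaf S y\<close> by blast
  qed
next
  case (Conj s t)
  then obtain p y where "path S (\<sigma>, s) p y" "is_leaf S y" by blast
  moreover from this have "path S (\<sigma>, Conj s t) (((\<sigma>, Conj s t), 0) # p) y" by (simp add: path_Cons)
  ultimately show ?case by blast
next
  case (Disj s t)
  then obtain p y where "path S (\<sigma>, s) p y" "is_leaf S y" by blast
  moreover from this have "path S (\<sigma>, Disj s t) (((\<sigma>, Disj s t), 0) # p) y" by (simp add: path_Cons)
  ultimately show ?case by blast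
qed (rule exI[of _ "[]"], rule exI, rule conjI, rule path_Nil, simp add: is_leaf_def)+

text \<open>A good branch whose root is not a Skeleton node has an empty Skeleton part, so it
  consists of PIA nodes, and every inner node lies on some branch.\<close>

lemma non_skeleton_pia_tree:
  assumes "analytic_inductive_tree S \<Omega> \<epsilon> x" "\<not> is_skeleton S x"
  shows "pia_tree S x"
  unfolding pia_tree_def
proof (intro allI impI, elim conjE)
  fix p y assume p: "path S x p y" and y: "\<not> is_leaf S y"
  obtain q z where q: "path S y q z" "is_leaf S z"
    using path_to_leaf[of S "fst y" "snd y"] by auto
  then have qy: "y \<in> set (map fst q)" using y by (auto simp: path_iff[of S y])
  have "path S x (p @ q) z" using p q path_append by blast
  moreover have "p @ q \<noteq> []" using qy by auto
  ultimately have hd: "map fst (p @ q) = x # tl (map fst (p @ q))"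
    by (auto simp: path_iff[of S x] map_append[symmetric] simp del: map_append)
  have "good_branch S (p @ q)"
    using \<open>path S x (p @ q) z\<close> assms(1) q(2) unfolding analytic_inductive_tree_def by blast
  then obtain ps qs where "x # tl (map fst (p @ q)) = ps @ qs"
    "\<forall>x\<in>set ps. is_skeleton S x" "\<forall>x\<in>set qs. is_pia S x"
    unfolding good_branch_def using hd by metis
  \<comment> \<open>A nonempty \<open>ps\<close> would begin with the root \<open>x\<close>, which
    is not a Skeleton node.\<close>
  with assms(2) hd have "\<forall>x\<in>set (map fst (p @ q)). is_pia S x"
    by (cases ps) auto
  then show "is_pia S y" using qy by auto
qed

section \<open>Signed occurrences of variables\<close>

lemma occurs_iff:
  "occurs S x \<sigma> q \<longleftrightarrow> x = (\<sigma>, Var q) \<or> (\<exists>i < length (children S x). occurs S (children S x ! i) \<sigma> q)"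
  unfolding occurs_def by (subst path_iff) blast

lemma occurs_simps [simp]:
  "occurs S (\<tau>, Var p) \<sigma> q \<longleftrightarrow> \<sigma> = \<tau> \<and> q = p"
  "\<not> occurs S (\<tau>, Bot) \<sigma> q"
  "\<not> occurs S (\<tau>, Top) \<sigma> q"
  "occurs S (\<tau>, Conj s t) \<sigma> q \<longleftrightarrow> occurs S (\<tau>, s) \<sigma> q \<or> occurs S (\<tau>, t) \<sigma> q"
  "occurs S (\<tau>, Disj s t) \<sigma> q \<longleftrightarrow> occurs S (\<tau>, s) \<sigma> q \<or> occurs S (\<tau>, t) \<sigma> q"
  using occurs_iff[of S "(\<tau>, Var p)" \<sigma> q] occurs_iff[of S "(\<tau>, Bot)" \<sigma> q]
    occurs_iff[of S "(\<tau>, Top)" \<sigma> q] occurs_iff[of S "(\<tau>, Conj s t)" \<sigma> q]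
    occurs_iff[of S "(\<tau>, Disj s t)" \<sigma> q]
  by (simp_all add: Ex_less_Suc2) blast

lemma occurs_Op:
  assumes "length ts = arity S h"
  shows "occurs S (\<tau>, Op h ts) \<sigma> q \<longleftrightarrow>
    (\<exists>i < length ts. occurs S (child_sign (otype S h ! i) \<tau>, ts ! i) \<sigma> q)"
  using assms by (subst occurs_iff) (auto simp: arity_def)

lemma occurs_vars: "wf_trm S t \<Longrightarrow> occurs S (\<tau>, t) \<sigma> q \<Longrightarrow> q \<in> vars t"
proof (induction t arbitrary: \<tau>)
  case (Op h ts)
  then obtain i where "i < length ts" "occurs S (child_sign (otype S h ! i) \<tau>, ts ! i) \<sigma> q"
    by (auto simp: occurs_Op)
  then show ?case using Op.IH[of "ts ! i"] Op.prems
    by (auto simp: list_all_length intro!: bexI[of _ "ts ! i"])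
qed auto

lemma agrees_occurs: "agrees S \<epsilon> x \<Longrightarrow> occurs S x \<sigma> q \<Longrightarrow> \<sigma> = child_sign (\<epsilon> q) Plus"
  unfolding agrees_def occurs_def by (metis critical_Var is_Var_def snd_conv)

lemma finite_vars: "finite (vars t)"
  by (induction t) auto

lemma eval_cong: "(\<And>q. q \<in> vars t \<Longrightarrow> v q = w q) \<Longrightarrow> eval I v t = eval I w t"
proof (induction t)
  case (Op h ts)
  then have "map (eval I v) ts = map (eval I w) ts" by (intro map_cong) auto
  then show ?case by (simp only: eval.simps)
qed auto


section \<open>Extended operations on signed terms\<close>

locale canext_algebra = canext e
  for e :: "'a::{distrib_lattice, bounded_lattice} \<Rightarrow> 'd::complete_lattice" +
  fixes S :: "'c signature" and I :: "'c \<Rightarrow> 'a list \<Rightarrow> 'a"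
  assumes signature: "le_signature S" and normal: "normal_dle S I"
begin

text \<open>The order whose joins the connective preserves. For a connective of the signature with
  arguments, a node is Skeleton when its sign is the kind and PIA when its sign is the
  opposite.\<close>

definition kind :: "'c \<Rightarrow> sign" where
  "kind h = (if h \<in> fconn S then Plus else Minus)"

abbreviation signs :: "'c \<Rightarrow> sign list" where
  "signs h \<equiv> map (\<lambda>\<eta>. child_sign \<eta> (kind h)) (otype S h)"

abbreviation J :: "'c \<Rightarrow> 'd list \<Rightarrow> 'd" where
  "J \<equiv> canext_ops S e I"

lemma op:
  assumes "h \<in> fconn S \<union> gconn S"
  shows "canext_op e (kind h) (signs h) (I h)"
proof
  fix as :: "'a list" and i x y
  assume l: "length as = length (signs h)" "i < length (signs h)"
  have f: "f_normal (otype S h) (I h)" if "h \<in> fconn S"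
    using normal that by (simp add: normal_dle_def)
  have g: "g_normal (otype S h) (I h)" if "h \<notin> fconn S"
    using normal assms that by (auto simp: normal_dle_def)
  have "I h (as[i := sbot (signs h ! i)]) = sbot (kind h) \<and>
      I h (as[i := sjoin (signs h ! i) x y]) = sjoin (kind h) (I h (as[i := x])) (I h (as[i := y]))"
  proof (cases "h \<in> fconn S")
    case True
    from f[OF this, unfolded f_normal_def, THEN spec, THEN spec, THEN mp, of as i] l True
    show ?thesis by (cases "otype S h ! i") (simp_all add: kind_def)
  next
    case False
    from g[OF this, unfolded g_normal_def, THEN spec, THEN spec, THEN mp, of as i] l False
    show ?thesis by (cases "otype S h ! i") (simp_all add: kind_def)
  qed
  then show "I h (as[i := sbot (signs h ! i)]) = sbot (kind h)"
    "I h (as[i := sjoin (signs h ! i) x y]) = sjoin (kind h) (I h (as[i := x])) (I h (as[i := y]))"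
    by blast+
qed

lemma variance_case:
  "(case \<eta> of One \<Rightarrow> x \<le> y | Dual \<Rightarrow> y \<le> x) \<longleftrightarrow> sle (child_sign \<eta> Plus) x y"
  "(case \<eta> of One \<Rightarrow> closed_elems e | Dual \<Rightarrow> open_elems e) = cl (child_sign \<eta> Plus)"
  "(case \<eta> of One \<Rightarrow> open_elems e | Dual \<Rightarrow> closed_elems e) = cl (child_sign \<eta> Minus)"
  "sle (child_sign \<eta> Minus) x y \<longleftrightarrow> sle (child_sign \<eta> Plus) y x"
  by (cases \<eta>; simp)+

text \<open>For a meet-preserving connective every argument sign is flipped, which turns
  \<open>le_otype\<close> into its converse.\<close>

lemma les_otype:
  assumes "h \<in> fconn S \<union> gconn S"
  shows "canext_op.les (signs h) xs ys \<longleftrightarrow>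
    (if h \<in> fconn S then le_otype (otype S h) xs ys else le_otype (otype S h) ys xs)"
  unfolding canext_op.les_def[OF op[OF assms]]
  unfolding le_otype_def kind_def variance_case
  by (auto simp: variance_case(4))

lemma cls_otype:
  assumes "h \<in> fconn S \<union> gconn S"
  shows "canext_op.cls e (signs h) =
    (if h \<in> fconn S then closed_tuples e (otype S h) else open_tuples e (otype S h))"
  unfolding canext_op.cls_def[OF op[OF assms]]
  unfolding closed_tuples_def open_tuples_def kind_def variance_case
  by auto

lemma J_eq_ext:
  assumes "h \<in> fconn S \<union> gconn S"
  shows "J h us = canext_op.ext e (kind h) (signs h) (I h) us"
  unfolding canext_op.ext_def[OF op[OF assms]] canext_op.ext_closed_def[OF op[OF assms]]
    les_otype[OF assms] cls_otype[OF assms]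
  by (simp add: kind_def canext_ops_def sigma_ext_def sigma_closed_def pi_ext_def pi_open_def)

section \<open>Extended operations in terms of the sign of a node\<close>

lemma op_les:
  assumes "h \<in> fconn S \<union> gconn S"
  shows "canext_op.les (signs h) xs ys \<longleftrightarrow> length xs = arity S h \<and> length ys = arity S h \<and>
    (\<forall>i < arity S h. sle (child_sign (otype S h ! i) (kind h)) (xs ! i) (ys ! i))"
  unfolding canext_op.les_def[OF op[OF assms]] by (auto simp: arity_def)

lemma child_sign_cases:
  assumes "\<sigma> \<noteq> kind h"
  shows "kind h = neg \<sigma>" "child_sign \<eta> (kind h) = neg (child_sign \<eta> \<sigma>)"
proof -
  show "kind h = neg \<sigma>" using assms neq_sign_iff by metis
  then show "child_sign \<eta> (kind h) = neg (child_sign \<eta> \<sigma>)" by (simp only: child_sign_neg)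
qed

lemma J_mono:
  assumes h: "h \<in> fconn S \<union> gconn S" and "length us = arity S h" "length us' = arity S h"
    and le: "\<And>i. i < arity S h \<Longrightarrow> sle (child_sign (otype S h ! i) \<sigma>) (us ! i) (us' ! i)"
  shows "sle \<sigma> (J h us) (J h us')"
proof (cases "\<sigma> = kind h")
  case True
  then show ?thesis
    using assms canext_op.ext_mono[OF op[OF h]] by (simp add: J_eq_ext[OF h] op_les[OF h])
next
  case False
  have "canext_op.les (signs h) us' us"
    unfolding op_les[OF h] using assms child_sign_cases(2)[OF False] by simp
  then have "sle (kind h) (J h us') (J h us)"
    unfolding J_eq_ext[OF h] by (rule canext_op.ext_mono[OF op[OF h]])
  then show ?thesis unfolding child_sign_cases(1)[OF False] by simp
qed

lemma J_e:
  assumes h: "h \<in> fconn S \<union> gconn S" and "length as = arity S h"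
  shows "J h (map e as) = e (I h as)"
  using assms canext_op.ext_e[OF op[OF h]] by (simp add: J_eq_ext[OF h] arity_def)

lemma J_join_generated:
  assumes h: "h \<in> fconn S \<union> gconn S" and "length us = arity S h"
    and "\<And>i. i < arity S h \<Longrightarrow>
      sle (child_sign (otype S h ! i) (kind h)) (us ! i) (sSup (child_sign (otype S h ! i) (kind h)) (X i))"
    and "\<And>cs. length cs = arity S h \<Longrightarrow> (\<And>i. i < arity S h \<Longrightarrow> cs ! i \<in> X i) \<Longrightarrow>
      sle (kind h) (J h cs) z"
  shows "sle (kind h) (J h us) z"
  unfolding J_eq_ext[OF h]
  using assms by (intro canext_op.ext_join_generated[OF op[OF h], of us X])
    (simp_all add: J_eq_ext[OF h] arity_def)

section \<open>Connectives in PIA position: open values, compactness and residuals\<close>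

lemma J_open:
  assumes h: "h \<in> fconn S \<union> gconn S" and "kind h = neg \<sigma>" and len: "length us = arity S h"
    and us: "\<And>i. i < arity S h \<Longrightarrow> us ! i \<in> cl (neg (child_sign (otype S h ! i) \<sigma>))"
  shows "J h us \<in> cl (neg \<sigma>)"
proof -
  have "us \<in> canext_op.cls e (signs h)"
    unfolding canext_op.cls_def[OF op[OF h]]
    using len us by (simp add: arity_def \<open>kind h = neg \<sigma>\<close> child_sign_neg)
  then show ?thesis
    using canext_op.ext_cls[OF op[OF h]] by (simp add: J_eq_ext[OF h] \<open>kind h = neg \<sigma>\<close>)
qed

lemma J_compact:
  assumes h: "h \<in> fconn S \<union> gconn S" and kind: "kind h = neg \<sigma>" and len: "length us = arity S h"
    and us: "\<And>i. i < arity S h \<Longrightarrow> us ! i \<in> cl (neg (child_sign (otype S h ! i) \<sigma>))"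
    and k: "k \<in> cl \<sigma>" "sle \<sigma> k (J h us)"
  shows "\<exists>as. length as = arity S h \<and> sle \<sigma> k (J h (map e as)) \<and>
    (\<forall>i < arity S h. sle (child_sign (otype S h ! i) \<sigma>) (e (as ! i)) (us ! i))"
proof -
  have "us \<in> canext_op.cls e (signs h)"
    unfolding canext_op.cls_def[OF op[OF h]]
    using len us by (simp add: arity_def kind child_sign_neg)
  moreover have "k \<in> cl (neg (kind h))" "sle (kind h) (J h us) k" using k kind by simp_all
  ultimately obtain as where as: "canext_op.les (signs h) us (map e as)"
      "sle (kind h) (e (I h as)) k"
    using canext_op.ext_compact[OF op[OF h], of us k] unfolding J_eq_ext[OF h] by blast
  then have len': "length as = arity S h" by (simp add: op_les[OF h])
  show ?thesis
  proof (intro exI[of _ as] conjI allI impI)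
    show "sle \<sigma> k (J h (map e as))" using as(2) J_e[OF h len'] kind by simp
    fix i assume "i < arity S h"
    then show "sle (child_sign (otype S h ! i) \<sigma>) (e (as ! i)) (us ! i)"
      using as(1)[unfolded op_les[OF h]] len' by (simp add: kind child_sign_neg)
  qed (fact len')
qed

lemma J_residual:
  assumes h: "h \<in> fconn S \<union> gconn S" and kind: "kind h = neg \<sigma>" and len: "length us = arity S h"
    and i: "i < arity S h"
    and us: "\<And>j. j < arity S h \<Longrightarrow> j \<noteq> i \<Longrightarrow> us ! j \<in> cl (neg (child_sign (otype S h ! j) \<sigma>))"
    and k: "k \<in> cl \<sigma>" "sle \<sigma> k (J h us)"
  shows "\<exists>x \<in> cl (child_sign (otype S h ! i) \<sigma>).
    sle (child_sign (otype S h ! i) \<sigma>) x (us ! i) \<and> sle \<sigma> k (J h (us[i := x]))"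
proof -
  have sgn: "signs h ! j = neg (child_sign (otype S h ! j) \<sigma>)" if "j < arity S h" for j
    using that by (simp add: arity_def kind child_sign_neg)
  have "\<exists>x \<in> cl (neg (signs h ! i)). sle (signs h ! i) (us ! i) x \<and>
      sle (kind h) (canext_op.ext e (kind h) (signs h) (I h) (us[i := x])) k"
  proof (rule canext_op.ext_residual[OF op[OF h]])
    show "i < length (signs h)" "length us = length (signs h)" using i len by (simp_all add: arity_def)
    show "k \<in> cl (neg (kind h))" using k kind by simp
    show "us ! j \<in> cl (signs h ! j)" if "j < length (signs h)" "j \<noteq> i" for j
      using that us[of j] sgn[of j] by (simp add: arity_def)
    show "sle (kind h) (canext_op.ext e (kind h) (signs h) (I h) us) k"
      unfolding J_eq_ext[OF h, symmetric] using k kind by simp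
  qed
  then show ?thesis
    unfolding J_eq_ext[OF h, symmetric] using sgn[OF i] kind by simp
qed


section \<open>Values of signed terms\<close>

lemma is_pia_kind: "h \<in> fconn S \<union> gconn S \<Longrightarrow> is_pia S (\<sigma>, Op h ts) \<longleftrightarrow> kind h = neg \<sigma>"
  using signature by (cases \<sigma>) (auto simp: kind_def le_signature_def)

lemma is_skeleton_kind: "h \<in> fconn S \<union> gconn S \<Longrightarrow> is_skeleton S (\<sigma>, Op h ts) \<longleftrightarrow> kind h = \<sigma>"
  using signature by (cases \<sigma>) (auto simp: kind_def le_signature_def)

lemma is_srr_kind:
  "h \<in> fconn S \<union> gconn S \<Longrightarrow> is_srr S (\<sigma>, Op h ts) \<longleftrightarrow> kind h = neg \<sigma> \<and> arity S h \<ge> 2"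
  using signature by (cases \<sigma>) (auto simp: kind_def le_signature_def)

lemma children_Op:
  "length ts = arity S h \<Longrightarrow> length (children S (\<sigma>, Op h ts)) = arity S h"
  "length ts = arity S h \<Longrightarrow> i < arity S h \<Longrightarrow>
    children S (\<sigma>, Op h ts) ! i = (child_sign (otype S h ! i) \<sigma>, ts ! i)"
  by (auto simp: arity_def)

lemma pia_tree_Conj:
  "pia_tree S (\<sigma>, Conj s t) \<Longrightarrow> \<sigma> = Plus \<and> pia_tree S (\<sigma>, s) \<and> pia_tree S (\<sigma>, t)"
  using pia_tree_child[of S "(\<sigma>, Conj s t)" 0] pia_tree_child[of S "(\<sigma>, Conj s t)" 1]
    pia_tree_root[of S "(\<sigma>, Conj s t)"]
  by (cases \<sigma>) auto

lemma pia_tree_Disj: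
  "pia_tree S (\<sigma>, Disj s t) \<Longrightarrow> \<sigma> = Minus \<and> pia_tree S (\<sigma>, s) \<and> pia_tree S (\<sigma>, t)"
  using pia_tree_child[of S "(\<sigma>, Disj s t)" 0] pia_tree_child[of S "(\<sigma>, Disj s t)" 1]
    pia_tree_root[of S "(\<sigma>, Disj s t)"]
  by (cases \<sigma>) auto

lemma pia_tree_Op:
  assumes "pia_tree S (\<sigma>, Op h ts)" "h \<in> fconn S \<union> gconn S" "length ts = arity S h" "i < arity S h"
  shows "kind h = neg \<sigma>" "pia_tree S (child_sign (otype S h ! i) \<sigma>, ts ! i)"
proof -
  have len: "i < length (children S (\<sigma>, Op h ts))"
    unfolding children_Op(1)[OF assms(3)] by (fact assms(4))
  then have "is_pia S (\<sigma>, Op h ts)" using assms(1) pia_tree_root by fastforce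
  then show "kind h = neg \<sigma>" using is_pia_kind assms(2) by blast
  show "pia_tree S (child_sign (otype S h ! i) \<sigma>, ts ! i)"
    using pia_tree_child[OF assms(1) len] unfolding children_Op(2)[OF assms(3,4)] .
qed

lemma eval_mono:
  assumes "wf_trm S t" "\<And>\<tau> q. occurs S (\<sigma>, t) \<tau> q \<Longrightarrow> sle \<tau> (v q) (w q)"
  shows "sle \<sigma> (eval J v t) (eval J w t)"
  using assms
proof (induction t arbitrary: \<sigma>)
  case (Conj s t)
  then have "sle \<sigma> (eval J v s) (eval J w s)" "sle \<sigma> (eval J v t) (eval J w t)" by auto
  then show ?case by (cases \<sigma>) (auto intro: le_infI1 le_infI2)
next
  case (Disj s t)
  then have "sle \<sigma> (eval J v s) (eval J w s)" "sle \<sigma> (eval J v t) (eval J w t)" by auto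
  then show ?case by (cases \<sigma>) (auto intro: le_supI1 le_supI2)
next
  case (Op h ts)
  then have wf: "h \<in> fconn S \<union> gconn S" "length ts = arity S h" "\<And>i. i < arity S h \<Longrightarrow> wf_trm S (ts ! i)"
    by (auto simp: list_all_length)
  show ?case unfolding eval.simps
  proof (rule J_mono[OF wf(1)])
    fix i assume i: "i < arity S h"
    have "sle (child_sign (otype S h ! i) \<sigma>) (eval J v (ts ! i)) (eval J w (ts ! i))"
      using Op.prems(2) wf i by (intro Op.IH) (auto simp: occurs_Op)
    then show "sle (child_sign (otype S h ! i) \<sigma>) (map (eval J v) ts ! i) (map (eval J w) ts ! i)"
      using i wf by simp
  qed (use wf in auto)
qed auto

text \<open>In PIA position a connective takes open arguments to an open value, each relative to its
  own sign; for the lattice connectives this is \<open>sjoin_in_cl\<close> in the dual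
  order.\<close>

lemma eval_open:
  assumes "wf_trm S t" "pia_tree S (\<sigma>, t)" "\<And>\<tau> q. occurs S (\<sigma>, t) \<tau> q \<Longrightarrow> v q \<in> cl (neg \<tau>)"
  shows "eval J v t \<in> cl (neg \<sigma>)"
  using assms
proof (induction t arbitrary: \<sigma>)
  case Bot
  then show ?case using stop_in_cl[of Minus] by simp
next
  case Top
  then show ?case using stop_in_cl[of Plus] by simp
next
  case (Conj s t)
  note pia = pia_tree_Conj[OF Conj.prems(2)]
  have "eval J v s \<in> cl (neg \<sigma>)" "eval J v t \<in> cl (neg \<sigma>)"
    using Conj.prems pia by (intro Conj.IH; simp)+
  then show ?case using sjoin_in_cl[of _ Minus] pia by simp
next
  case (Disj s t)
  note pia = pia_tree_Disj[OF Disj.prems(2)]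
  have "eval J v s \<in> cl (neg \<sigma>)" "eval J v t \<in> cl (neg \<sigma>)"
    using Disj.prems pia by (intro Disj.IH; simp)+
  then show ?case using sjoin_in_cl[of _ Plus] pia by simp
next
  case (Op h ts)
  then have wf: "h \<in> fconn S \<union> gconn S" "length ts = arity S h" "\<And>i. i < arity S h \<Longrightarrow> wf_trm S (ts ! i)"
    by (auto simp: list_all_length)
  show ?case
  \<comment> \<open>A nullary connective is a leaf and need not be a PIA node, but its value is the
    image of a lattice element and hence both closed and open.\<close>
  proof (cases "arity S h = 0")
    case True
    then show ?thesis using J_e[OF wf(1), of "[]"] wf(2) by simp
  next
    case False
    then have "kind h = neg \<sigma>" using pia_tree_Op(1)[OF Op.prems(2) wf(1,2)] by auto
    then show ?thesis unfolding eval.simps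
    proof (rule J_open[OF wf(1)])
      fix i assume i: "i < arity S h"
      have "eval J v (ts ! i) \<in> cl (neg (child_sign (otype S h ! i) \<sigma>))"
        using Op.prems(3) pia_tree_Op(2)[OF Op.prems(2) wf(1,2) i] wf i
        by (intro Op.IH) (auto simp: occurs_Op)
      then show "map (eval J v) ts ! i \<in> cl (neg (child_sign (otype S h ! i) \<sigma>))"
        using i wf by simp
    qed (use wf in simp)
  qed
qed auto

lemma eval_e:
  assumes "wf_trm S t"
  shows "eval J (\<lambda>q. e (v q)) t = e (eval I v t)"
  using assms
proof (induction t)
  case (Op h ts)
  then have "map (eval J (\<lambda>q. e (v q))) ts = map e (map (eval I v) ts)"
    by (auto simp: list_all_iff)
  moreover have "J h (map e (map (eval I v) ts)) = e (I h (map (eval I v) ts))"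
    using Op.prems by (intro J_e) auto
  ultimately show ?case by (simp only: eval.simps)
qed (auto simp: embedding)

end


section \<open>Approximating assignments\<close>

locale inductive_order = canext_algebra e S I
  for e :: "'a::{distrib_lattice, bounded_lattice} \<Rightarrow> 'd::complete_lattice"
    and S :: "'c signature" and I :: "'c \<Rightarrow> 'a list \<Rightarrow> 'a" +
  fixes \<Omega> :: "'v \<Rightarrow> 'v \<Rightarrow> bool" and \<epsilon> :: "'v \<Rightarrow> variance"
  assumes irrefl: "irreflp \<Omega>" and trans: "transp \<Omega>"
begin

text \<open>The sign under which \<open>q\<close> is critical. It also fixes the direction in which
  \<open>q\<close> is lowered or raised and the kind of value, closed or open, that it is lowered
  to.\<close>

abbreviation crit :: "'v \<Rightarrow> sign" where
  "crit q \<equiv> child_sign (\<epsilon> q) Plus"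

lemma critical_sibling:
  assumes ind: "inductive_tree S \<Omega> \<epsilon> (\<sigma>, Op h ts)"
    and h: "h \<in> fconn S \<union> gconn S" "length ts = arity S h" "kind h = neg \<sigma>"
    and i: "i < arity S h" "occurs S (child_sign (otype S h ! i) \<sigma>, ts ! i) (crit q) q"
    and j: "j < arity S h" "j \<noteq> i"
  shows "occurs S (child_sign (otype S h ! j) \<sigma>, ts ! j) \<tau> r \<Longrightarrow> \<tau> = neg (crit r)"
    "r \<in> vars (ts ! j) \<Longrightarrow> \<Omega> r q"
proof -
  \<comment> \<open>The existence of a second position \<open>j\<close> forces arity at least two,
    so the side condition applies.\<close>
  have "is_srr S (\<sigma>, Op h ts)" unfolding is_srr_kind[OF h(1)] using h(3) i(1) j by simp
  then have *: "agrees S (opp \<circ> \<epsilon>) (children S (\<sigma>, Op h ts) ! j)"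
    "\<And>r. r \<in> vars (snd (children S (\<sigma>, Op h ts) ! j)) \<Longrightarrow> \<Omega> r q"
    using inductive_tree_sibling[OF ind, of i q j] i j
    unfolding children_Op(1)[OF h(2)] children_Op(2)[OF h(2) i(1)] by blast+
  note * = *[unfolded children_Op(2)[OF h(2) j(1)]]
  show "\<tau> = neg (crit r)" if "occurs S (child_sign (otype S h ! j) \<sigma>, ts ! j) \<tau> r"
    using agrees_occurs[OF *(1) that] by (cases "\<epsilon> r") auto
  show "\<Omega> r q" if "r \<in> vars (ts ! j)" using *(2) that by simp
qed

text \<open>Residuation moves the bound \<open>k\<close> on a PIA term to a bound \<open>x\<close>
  on its \<open>i\<close>-th argument, valid for all assignments that leave the other arguments
  unchanged.\<close>

lemma residual_step:
  assumes h: "h \<in> fconn S \<union> gconn S" "length ts = arity S h" "kind h = neg \<sigma>"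
    and i: "i < arity S h"
    and op: "\<And>j. j < arity S h \<Longrightarrow> j \<noteq> i \<Longrightarrow> eval J v (ts ! j) \<in> cl (neg (child_sign (otype S h ! j) \<sigma>))"
    and k: "k \<in> cl \<sigma>" "sle \<sigma> k (eval J v (Op h ts))"
  shows "\<exists>x \<in> cl (child_sign (otype S h ! i) \<sigma>).
    sle (child_sign (otype S h ! i) \<sigma>) x (eval J v (ts ! i)) \<and>
    (\<forall>w. (\<forall>j < arity S h. j \<noteq> i \<longrightarrow> eval J w (ts ! j) = eval J v (ts ! j)) \<longrightarrow>
      sle (child_sign (otype S h ! i) \<sigma>) x (eval J w (ts ! i)) \<longrightarrow> sle \<sigma> k (eval J w (Op h ts)))"
proof -
  let ?us = "map (eval J v) ts"
  have "\<exists>x \<in> cl (child_sign (otype S h ! i) \<sigma>).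
    sle (child_sign (otype S h ! i) \<sigma>) x (?us ! i) \<and> sle \<sigma> k (J h (?us[i := x]))"
    using op k h(2) i by (intro J_residual[OF h(1,3)]) auto
  then obtain x where x: "x \<in> cl (child_sign (otype S h ! i) \<sigma>)"
    "sle (child_sign (otype S h ! i) \<sigma>) x (?us ! i)" "sle \<sigma> k (J h (?us[i := x]))" by blast
  have "sle \<sigma> k (eval J w (Op h ts))"
    if "\<forall>j < arity S h. j \<noteq> i \<longrightarrow> eval J w (ts ! j) = eval J v (ts ! j)"
      "sle (child_sign (otype S h ! i) \<sigma>) x (eval J w (ts ! i))" for w
  proof -
    have "sle \<sigma> (J h (?us[i := x])) (J h (map (eval J w) ts))"
      using that h(2) i by (intro J_mono[OF h(1)]) (auto simp: nth_list_update)
    then show ?thesis using x(3) by (simp only: eval.simps) (rule sle_trans)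
  qed
  then show ?thesis using x h(2) i by (intro bexI[of _ x]) auto
qed

text \<open>The bound \<open>k\<close> is pushed down to the critical occurrences of
  \<open>p\<close>. Side arguments met on the way contain only variables
  \<open>\<Omega>\<close>-below \<open>p\<close>, in non-critical sign, so they have open values and
  do not change with \<open>p\<close>. Claiming the whole interval from \<open>c0\<close> to
  \<open>v p\<close> lets bounds from several subterms be combined by a join.\<close>

lemma lower_to_closed:
  assumes "wf_trm S t" "pia_tree S (\<sigma>, t)" "inductive_tree S \<Omega> \<epsilon> (\<sigma>, t)"
    and "k \<in> cl \<sigma>" "sle \<sigma> k (eval J v t)"
    and below: "\<And>r. \<Omega> r p \<Longrightarrow> v r \<in> cl (crit r)"
  shows "\<exists>c0 \<in> cl (crit p). sle (crit p) c0 (v p) \<and>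
    (\<forall>c. sle (crit p) c0 c \<longrightarrow> sle (crit p) c (v p) \<longrightarrow> sle \<sigma> k (eval J (v(p := c)) t))"
  using assms(1-5)
proof (induction t arbitrary: \<sigma> k)
  case (Var q)
  show ?case
  \<comment> \<open>At a critical leaf \<open>k\<close> itself is the lower end. A non-critical
    occurrence of \<open>p\<close> only gains when \<open>p\<close> is lowered, so any lower end
    works there.\<close>
  proof (cases "q = p \<and> \<sigma> = crit p")
    case True
    then show ?thesis using Var by (intro bexI[of _ k]) auto
  next
    case False
    then have "sle \<sigma> k ((v(p := c)) q)" if "sle (crit p) c (v p)" for c
      using that Var.prems(5) neq_sign_iff[of \<sigma> "crit p"] by (auto intro: sle_trans)
    then show ?thesis by (intro bexI[of _ "sbot (crit p)"]) auto
  qed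
next
  case (Conj s t)
  note pia = pia_tree_Conj[OF Conj.prems(2)]
  have wf: "wf_trm S s" "wf_trm S t" using Conj.prems(1) by simp_all
  have le: "sle \<sigma> k (eval J v s)" "sle \<sigma> k (eval J v t)" using Conj.prems(5) pia by auto
  have ind: "inductive_tree S \<Omega> \<epsilon> (\<sigma>, s)" "inductive_tree S \<Omega> \<epsilon> (\<sigma>, t)"
    using inductive_tree_child[OF Conj.prems(3), of 0] inductive_tree_child[OF Conj.prems(3), of 1]
    by auto
  obtain c where c: "c \<in> cl (crit p)" "sle (crit p) c (v p)"
    "\<And>x. sle (crit p) c x \<Longrightarrow> sle (crit p) x (v p) \<Longrightarrow> sle \<sigma> k (eval J (v(p := x)) s)"
    using Conj.IH(1)[OF wf(1) _ ind(1) Conj.prems(4) le(1)] pia by blast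
  obtain d where d: "d \<in> cl (crit p)" "sle (crit p) d (v p)"
    "\<And>x. sle (crit p) d x \<Longrightarrow> sle (crit p) x (v p) \<Longrightarrow> sle \<sigma> k (eval J (v(p := x)) t)"
    using Conj.IH(2)[OF wf(2) _ ind(2) Conj.prems(4) le(2)] pia by blast
  show ?case
    using c d pia by (intro bexI[of _ "sjoin (crit p) c d"]) (auto intro: sjoin_in_cl simp del: fun_upd_apply)
next
  case (Disj s t)
  note pia = pia_tree_Disj[OF Disj.prems(2)]
  have wf: "wf_trm S s" "wf_trm S t" using Disj.prems(1) by simp_all
  have le: "sle \<sigma> k (eval J v s)" "sle \<sigma> k (eval J v t)" using Disj.prems(5) pia by auto
  have ind: "inductive_tree S \<Omega> \<epsilon> (\<sigma>, s)" "inductive_tree S \<Omega> \<epsilon> (\<sigma>, t)"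
    using inductive_tree_child[OF Disj.prems(3), of 0] inductive_tree_child[OF Disj.prems(3), of 1]
    by auto
  obtain c where c: "c \<in> cl (crit p)" "sle (crit p) c (v p)"
    "\<And>x. sle (crit p) c x \<Longrightarrow> sle (crit p) x (v p) \<Longrightarrow> sle \<sigma> k (eval J (v(p := x)) s)"
    using Disj.IH(1)[OF wf(1) _ ind(1) Disj.prems(4) le(1)] pia by blast
  obtain d where d: "d \<in> cl (crit p)" "sle (crit p) d (v p)"
    "\<And>x. sle (crit p) d x \<Longrightarrow> sle (crit p) x (v p) \<Longrightarrow> sle \<sigma> k (eval J (v(p := x)) t)"
    using Disj.IH(2)[OF wf(2) _ ind(2) Disj.prems(4) le(2)] pia by blast
  show ?case
    using c d pia by (intro bexI[of _ "sjoin (crit p) c d"]) (auto intro: sjoin_in_cl simp del: fun_upd_apply)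
next
  case (Op h ts)
  then have wf: "h \<in> fconn S \<union> gconn S" "length ts = arity S h" "\<And>i. i < arity S h \<Longrightarrow> wf_trm S (ts ! i)"
    by (auto simp: list_all_length)
  let ?s = "\<lambda>i. child_sign (otype S h ! i) \<sigma>"
  show ?case
  proof (cases "\<exists>i < arity S h. occurs S (?s i, ts ! i) (crit p) p")
    case True
    then obtain i where i: "i < arity S h" and occ: "occurs S (?s i, ts ! i) (crit p) p" by blast
    note pia = pia_tree_Op[OF Op.prems(2) wf(1,2)]
    note sib = critical_sibling[OF Op.prems(3) wf(1,2) pia(1)[OF i] i occ]
    have op: "eval J v (ts ! j) \<in> cl (neg (?s j))" if j: "j < arity S h" "j \<noteq> i" for j
    proof (rule eval_open)
      fix \<tau> r assume "occurs S (?s j, ts ! j) \<tau> r"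
      then show "v r \<in> cl (neg \<tau>)"
        using sib[OF j] below occurs_vars[OF wf(3)[OF j(1)]] by fastforce
    qed (use wf pia j in auto)
    obtain x where x: "x \<in> cl (?s i)" "sle (?s i) x (eval J v (ts ! i))"
      "\<And>w. (\<forall>j < arity S h. j \<noteq> i \<longrightarrow> eval J w (ts ! j) = eval J v (ts ! j)) \<Longrightarrow>
        sle (?s i) x (eval J w (ts ! i)) \<Longrightarrow> sle \<sigma> k (eval J w (Op h ts))"
      using residual_step[OF wf(1,2) pia(1)[OF i] i op Op.prems(4,5)] by blast
    have "inductive_tree S \<Omega> \<epsilon> (?s i, ts ! i)"
      using inductive_tree_child[OF Op.prems(3), of i] wf(2) i by (simp only: children_Op)
    then obtain c where c: "c \<in> cl (crit p)" "sle (crit p) c (v p)"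
      "\<And>y. sle (crit p) c y \<Longrightarrow> sle (crit p) y (v p) \<Longrightarrow> sle (?s i) x (eval J (v(p := y)) (ts ! i))"
      using Op.IH[OF _ wf(3)[OF i] pia(2)[OF i] _ x(1,2)] wf(2) i \<open>inductive_tree S \<Omega> \<epsilon> (?s i, ts ! i)\<close>
      by (metis nth_mem)
    have "eval J (v(p := y)) (ts ! j) = eval J v (ts ! j)" if j: "j < arity S h" "j \<noteq> i" for j y
    proof (rule eval_cong)
      fix r assume "r \<in> vars (ts ! j)"
      then have "\<Omega> r p" using sib[OF j] by blast
      then show "(v(p := y)) r = v r" using irrefl by (auto simp: irreflp_def)
    qed
    then show ?thesis using c x(3) by (intro bexI[of _ c]) blast+
  next
    \<comment> \<open>Without a critical occurrence of \<open>p\<close> in the term, lowering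
      \<open>p\<close> can only improve the value, by monotonicity.\<close>
    case False
    have "sle \<sigma> k (eval J (v(p := c)) (Op h ts))" if "sle (crit p) c (v p)" for c
    proof -
      have "sle \<sigma> (eval J v (Op h ts)) (eval J (v(p := c)) (Op h ts))"
      proof (rule eval_mono[OF Op.prems(1)])
        fix \<tau> q assume "occurs S (\<sigma>, Op h ts) \<tau> q"
        then have "q = p \<Longrightarrow> \<tau> = neg (crit p)"
          using False wf(2) neq_sign_iff[of \<tau> "crit p"] by (auto simp: occurs_Op)
        then show "sle \<tau> (v q) ((v(p := c)) q)" using that by auto
      qed
      then show ?thesis using Op.prems(5) sle_trans by blast
    qed
    then show ?thesis by (intro bexI[of _ "sbot (crit p)"]) (auto simp del: fun_upd_apply)
  qed
qed (auto intro!: bexI[of _ "sbot (crit p)"])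

text \<open>Raising \<open>p\<close> endangers only its non-critical occurrences, where an open
  bound leaves room for a lattice element. If all arguments of a connective are open, compactness
  replaces them by lattice elements serving as new bounds; otherwise the bound is residuated into an
  argument that contains a variable whose value is not open for its sign.\<close>

lemma raise_to_lattice:
  assumes "wf_trm S t" "pia_tree S (\<sigma>, t)" "inductive_tree S \<Omega> \<epsilon> (\<sigma>, t)"
    and "k \<in> cl \<sigma>" "sle \<sigma> k (eval J v t)"
    and cl: "\<And>r. v r \<in> cl (crit r)" and above: "\<And>r. \<Omega> p r \<Longrightarrow> v r \<in> range e"
  shows "\<exists>a0. sle (crit p) (v p) (e a0) \<and>
    (\<forall>a. sle (crit p) (v p) (e a) \<longrightarrow> sle (crit p) a a0 \<longrightarrow> sle \<sigma> k (eval J (v(p := e a)) t))"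
  using assms(1-5)
proof (induction t arbitrary: \<sigma> k)
  case (Var q)
  show ?case
  proof (cases "q = p \<and> \<sigma> = neg (crit p)")
    case True
    \<comment> \<open>In the order of \<open>crit p\<close> the bound \<open>k\<close> is open and
      lies above the closed \<open>v p\<close>, so a lattice element fits in between.\<close>
    then obtain a where "sle (crit p) (v p) (e a)" "sle (crit p) (e a) k"
      using interpolate[OF cl, of k p] Var by auto
    then show ?thesis using True
      by (intro exI[of _ a]) (auto intro: sle_trans[OF e_sle_iff[THEN iffD2]])
  next
    case False
    then have "sle \<sigma> k ((v(p := e a)) q)" if "sle (crit p) (v p) (e a)" for a
      using that Var.prems(5) neq_sign_iff[of \<sigma> "neg (crit p)"] by (auto intro: sle_trans)
    then show ?thesis by (intro exI[of _ "stop (crit p)"]) (auto simp: e_stop)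
  qed
next
  case (Conj s t)
  note pia = pia_tree_Conj[OF Conj.prems(2)]
  have wf: "wf_trm S s" "wf_trm S t" using Conj.prems(1) by simp_all
  have le: "sle \<sigma> k (eval J v s)" "sle \<sigma> k (eval J v t)" using Conj.prems(5) pia by auto
  have ind: "inductive_tree S \<Omega> \<epsilon> (\<sigma>, s)" "inductive_tree S \<Omega> \<epsilon> (\<sigma>, t)"
    using inductive_tree_child[OF Conj.prems(3), of 0] inductive_tree_child[OF Conj.prems(3), of 1]
    by auto
  obtain c where c: "sle (crit p) (v p) (e c)"
    "\<And>x. sle (crit p) (v p) (e x) \<Longrightarrow> sle (crit p) x c \<Longrightarrow> sle \<sigma> k (eval J (v(p := e x)) s)"
    using Conj.IH(1)[OF wf(1) _ ind(1) Conj.prems(4) le(1)] pia by blast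
  obtain d where d: "sle (crit p) (v p) (e d)"
    "\<And>x. sle (crit p) (v p) (e x) \<Longrightarrow> sle (crit p) x d \<Longrightarrow> sle \<sigma> k (eval J (v(p := e x)) t)"
    using Conj.IH(2)[OF wf(2) _ ind(2) Conj.prems(4) le(2)] pia by blast
  show ?case
    using c d pia by (intro exI[of _ "smeet (crit p) c d"]) (auto simp: e_smeet simp del: fun_upd_apply)
next
  case (Disj s t)
  note pia = pia_tree_Disj[OF Disj.prems(2)]
  have wf: "wf_trm S s" "wf_trm S t" using Disj.prems(1) by simp_all
  have le: "sle \<sigma> k (eval J v s)" "sle \<sigma> k (eval J v t)" using Disj.prems(5) pia by auto
  have ind: "inductive_tree S \<Omega> \<epsilon> (\<sigma>, s)" "inductive_tree S \<Omega> \<epsilon> (\<sigma>, t)"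
    using inductive_tree_child[OF Disj.prems(3), of 0] inductive_tree_child[OF Disj.prems(3), of 1]
    by auto
  obtain c where c: "sle (crit p) (v p) (e c)"
    "\<And>x. sle (crit p) (v p) (e x) \<Longrightarrow> sle (crit p) x c \<Longrightarrow> sle \<sigma> k (eval J (v(p := e x)) s)"
    using Disj.IH(1)[OF wf(1) _ ind(1) Disj.prems(4) le(1)] pia by blast
  obtain d where d: "sle (crit p) (v p) (e d)"
    "\<And>x. sle (crit p) (v p) (e x) \<Longrightarrow> sle (crit p) x d \<Longrightarrow> sle \<sigma> k (eval J (v(p := e x)) t)"
    using Disj.IH(2)[OF wf(2) _ ind(2) Disj.prems(4) le(2)] pia by blast
  show ?case
    using c d pia by (intro exI[of _ "smeet (crit p) c d"]) (auto simp: e_smeet simp del: fun_upd_apply)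
next
  case (Op h ts)
  then have wf: "h \<in> fconn S \<union> gconn S" "length ts = arity S h" "\<And>i. i < arity S h \<Longrightarrow> wf_trm S (ts ! i)"
    by (auto simp: list_all_length)
  let ?s = "\<lambda>i. child_sign (otype S h ! i) \<sigma>"
  note pia = pia_tree_Op[OF Op.prems(2) wf(1,2)]
  have ind: "inductive_tree S \<Omega> \<epsilon> (?s i, ts ! i)" if "i < arity S h" for i
    using inductive_tree_child[OF Op.prems(3), of i] wf(2) that by (simp only: children_Op)
  show ?case
  proof (cases "\<exists>i < arity S h. \<exists>\<tau> q. occurs S (?s i, ts ! i) \<tau> q \<and> v q \<notin> cl (neg \<tau>)")
    case True
    then obtain i \<tau> q where i: "i < arity S h" and occ: "occurs S (?s i, ts ! i) \<tau> q"
      and q: "v q \<notin> cl (neg \<tau>)" by blast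
    \<comment> \<open>A non-critical occurrence of \<open>q\<close> would be open for its sign,
      since \<open>v q\<close> is in \<open>cl (crit q)\<close>.\<close>
    have "\<tau> = crit q" using q cl[of q] neq_sign_iff[of \<tau> "crit q"] by auto
    note sib = critical_sibling[OF Op.prems(3) wf(1,2) pia(1)[OF i] i occ[unfolded this]]
    have op: "eval J v (ts ! j) \<in> cl (neg (?s j))" if j: "j < arity S h" "j \<noteq> i" for j
    proof (rule eval_open)
      fix \<tau> r assume "occurs S (?s j, ts ! j) \<tau> r"
      then have "\<tau> = neg (crit r)" using sib[OF j] by blast
      then show "v r \<in> cl (neg \<tau>)" using cl by simp
    qed (use wf pia j in auto)
    obtain x where x: "x \<in> cl (?s i)" "sle (?s i) x (eval J v (ts ! i))"
      "\<And>w. (\<forall>j < arity S h. j \<noteq> i \<longrightarrow> eval J w (ts ! j) = eval J v (ts ! j)) \<Longrightarrow>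
        sle (?s i) x (eval J w (ts ! i)) \<Longrightarrow> sle \<sigma> k (eval J w (Op h ts))"
      using residual_step[OF wf(1,2) pia(1)[OF i] i op Op.prems(4,5)] by blast
    obtain c where c: "sle (crit p) (v p) (e c)"
      "\<And>a. sle (crit p) (v p) (e a) \<Longrightarrow> sle (crit p) a c \<Longrightarrow> sle (?s i) x (eval J (v(p := e a)) (ts ! i))"
      using Op.IH[OF _ wf(3)[OF i] pia(2)[OF i] ind[OF i] x(1,2)] wf(2) i by (metis nth_mem)
    have "eval J (v(p := y)) (ts ! j) = eval J v (ts ! j)" if j: "j < arity S h" "j \<noteq> i" for j y
    proof (rule eval_cong)
      fix r assume "r \<in> vars (ts ! j)"
      then have "\<Omega> r q" using sib[OF j] by blast
      \<comment> \<open>If \<open>p\<close> occurred in a side argument, \<open>\<Omega> p q\<close>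
        would hold and \<open>v q\<close> would be in the lattice, hence both closed and
        open.\<close>
      then have "r \<noteq> p" using above[of q] q e_in_cl by auto
      then show "(v(p := y)) r = v r" by simp
    qed
    then show ?thesis using c x(3) by (intro exI[of _ c]) blast
  next
    case False
    show ?thesis
    proof (cases "arity S h = 0")
      case True
      then show ?thesis
        using wf(2) Op.prems by (intro exI[of _ "stop (crit p)"]) (auto simp: e_stop)
    next
      case nonzero: False
      then have kind: "kind h = neg \<sigma>" using pia(1) by blast
      let ?us = "map (eval J v) ts"
      have "eval J v (ts ! i) \<in> cl (neg (?s i))" if "i < arity S h" for i
        using that False wf pia by (intro eval_open) auto
      then obtain as where as: "length as = arity S h" "sle \<sigma> k (J h (map e as))"
        "\<And>i. i < arity S h \<Longrightarrow> sle (?s i) (e (as ! i)) (eval J v (ts ! i))"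
        using J_compact[OF wf(1) kind, of ?us k] wf(2) Op.prems(4,5) by auto
      have "\<exists>a0. sle (crit p) (v p) (e a0) \<and> (\<forall>a. sle (crit p) (v p) (e a) \<longrightarrow>
          sle (crit p) a a0 \<longrightarrow> sle (?s i) (e (as ! i)) (eval J (v(p := e a)) (ts ! i)))"
        if "i < arity S h" for i
        using that wf pia ind as by (intro Op.IH) auto
      then obtain b where b: "\<And>i. i < arity S h \<Longrightarrow> sle (crit p) (v p) (e (b i))"
        "\<And>i a. i < arity S h \<Longrightarrow> sle (crit p) (v p) (e a) \<Longrightarrow> sle (crit p) a (b i) \<Longrightarrow>
          sle (?s i) (e (as ! i)) (eval J (v(p := e a)) (ts ! i))"
        by metis
      let ?D = "{a. sle (crit p) (v p) (e a)}"
      \<comment> \<open>Each argument yields its own upper end \<open>b i\<close>; a common one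
        above \<open>v p\<close> is needed because \<open>p\<close> may occur in several
        arguments.\<close>
      have "\<exists>z\<in>?D. \<forall>x\<in>b ` {..<arity S h}. sle (crit p) z x"
      proof (rule sle_lower_bound_finite)
        show "?D \<noteq> {}" using e_stop sle_stop by (metis (mono_tags) empty_iff mem_Collect_eq)
        show "\<exists>z\<in>?D. sle (crit p) z x \<and> sle (crit p) z y" if "x \<in> ?D" "y \<in> ?D" for x y
          by (rule bexI[of _ "smeet (crit p) x y"]) (use that in \<open>simp_all add: e_smeet\<close>)
      qed (use b in auto)
      then obtain z where z: "sle (crit p) (v p) (e z)" "\<And>i. i < arity S h \<Longrightarrow> sle (crit p) z (b i)"
        by auto
      have "sle \<sigma> k (eval J (v(p := e a)) (Op h ts))"
        if a: "sle (crit p) (v p) (e a)" "sle (crit p) a z" for a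
      proof -
        have "sle \<sigma> (J h (map e as)) (J h (map (eval J (v(p := e a))) ts))"
        proof (rule J_mono[OF wf(1)])
          fix i assume i: "i < arity S h"
          have "sle (?s i) (e (as ! i)) (eval J (v(p := e a)) (ts ! i))"
            using b(2)[OF i a(1)] z(2)[OF i] a(2) sle_trans by blast
          then show "sle (?s i) (map e as ! i) (map (eval J (v(p := e a))) ts ! i)"
            using i as(1) wf(2) by simp
        qed (use as wf in auto)
        then show ?thesis using as(2) unfolding eval.simps by (meson sle_trans)
      qed
      then show ?thesis using z(1) by blast
    qed
  qed
qed (auto simp: e_stop intro!: exI[of _ "stop (crit p)"])


section \<open>Finite systems of bounds on PIA terms\<close>

definition pia_constraint :: "sign \<times> ('c, 'v) trm \<times> 'd \<Rightarrow> bool" where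
  "pia_constraint x \<longleftrightarrow> (case x of (\<sigma>, t, k) \<Rightarrow> wf_trm S t \<and> pia_tree S (\<sigma>, t) \<and>
     inductive_tree S \<Omega> \<epsilon> (\<sigma>, t) \<and> k \<in> cl \<sigma>)"

definition sat :: "('v \<Rightarrow> 'd) \<Rightarrow> sign \<times> ('c, 'v) trm \<times> 'd \<Rightarrow> bool" where
  "sat v x \<longleftrightarrow> (case x of (\<sigma>, t, k) \<Rightarrow> sle \<sigma> k (eval J v t))"

text \<open>The intervals obtained for single constraints all reach up to \<open>v p\<close>, so
  finitely many of them share a closed lower end, the join.\<close>

lemma lower_to_closed_all:
  assumes "finite C" "\<And>x. x \<in> C \<Longrightarrow> pia_constraint x \<and> sat v x"
    and below: "\<And>r. \<Omega> r p \<Longrightarrow> v r \<in> cl (crit r)"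
  shows "\<exists>c \<in> cl (crit p). \<forall>x\<in>C. sat (v(p := c)) x"
proof -
  have "\<exists>c0 \<in> cl (crit p). sle (crit p) c0 (v p) \<and>
    (\<forall>c. sle (crit p) c0 c \<longrightarrow> sle (crit p) c (v p) \<longrightarrow> (\<forall>x\<in>C. sat (v(p := c)) x))"
    using assms(1,2)
  proof (induction C rule: finite_induct)
    case empty
    then show ?case by (intro bexI[of _ "sbot (crit p)"]) auto
  next
    case (insert x C)
    obtain \<sigma> t k where x: "x = (\<sigma>, t, k)" by (cases x)
    have *: "pia_constraint x" "sat v x" using insert.prems by auto
    obtain c where c: "c \<in> cl (crit p)" "sle (crit p) c (v p)"
      "\<And>y. sle (crit p) c y \<Longrightarrow> sle (crit p) y (v p) \<Longrightarrow> sat (v(p := y)) x"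
      using lower_to_closed[of t \<sigma> k v p] * below unfolding x pia_constraint_def sat_def by auto
    obtain d where d: "d \<in> cl (crit p)" "sle (crit p) d (v p)"
      "\<And>y. sle (crit p) d y \<Longrightarrow> sle (crit p) y (v p) \<Longrightarrow> \<forall>x\<in>C. sat (v(p := y)) x"
      using insert.IH[OF insert.prems[OF insertI2]] by blast
    show ?case
      using c d by (intro bexI[of _ "sjoin (crit p) c d"])
        (auto intro: sjoin_in_cl simp del: fun_upd_apply)
  qed
  then show ?thesis using sle_refl by blast
qed

lemma raise_to_lattice_all:
  assumes "finite C" "\<And>x. x \<in> C \<Longrightarrow> pia_constraint x \<and> sat v x"
    and cl: "\<And>r. v r \<in> cl (crit r)" and above: "\<And>r. \<Omega> p r \<Longrightarrow> v r \<in> range e"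
  shows "\<exists>a. \<forall>x\<in>C. sat (v(p := e a)) x"
proof -
  have "\<exists>a0. sle (crit p) (v p) (e a0) \<and>
    (\<forall>a. sle (crit p) (v p) (e a) \<longrightarrow> sle (crit p) a a0 \<longrightarrow> (\<forall>x\<in>C. sat (v(p := e a)) x))"
    using assms(1,2)
  proof (induction C rule: finite_induct)
    case empty
    then show ?case by (intro exI[of _ "stop (crit p)"]) (auto simp: e_stop)
  next
    case (insert x C)
    obtain \<sigma> t k where x: "x = (\<sigma>, t, k)" by (cases x)
    have *: "pia_constraint x" "sat v x" using insert.prems by auto
    obtain c where c: "sle (crit p) (v p) (e c)"
      "\<And>a. sle (crit p) (v p) (e a) \<Longrightarrow> sle (crit p) a c \<Longrightarrow> sat (v(p := e a)) x"
      using raise_to_lattice[of t \<sigma> k v p] * cl above unfolding x pia_constraint_def sat_def by auto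
    obtain d where d: "sle (crit p) (v p) (e d)"
      "\<And>a. sle (crit p) (v p) (e a) \<Longrightarrow> sle (crit p) a d \<Longrightarrow> \<forall>x\<in>C. sat (v(p := e a)) x"
      using insert.IH[OF insert.prems[OF insertI2]] by blast
    show ?case
      using c d by (intro exI[of _ "smeet (crit p) c d"]) (auto simp: e_smeet simp del: fun_upd_apply)
  qed
  then show ?thesis using sle_refl by blast
qed

section \<open>Treating the variables one by one along \<open>\<Omega>\<close>\<close>

lemma asymp_on_order: "asymp_on A \<Omega>"
  by (rule asymp_onI) (meson irrefl trans transpD irreflpD)

lemma transp_on_order: "transp_on A \<Omega>"
  by (rule transp_onI) (meson trans transpD)

text \<open>Induction on the number of variables whose value is not yet of the required kind.
  Choosing an \<open>\<Omega>\<close>-minimal one ensures that everything below it has been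
  treated.\<close>

lemma ex_closed_assignment:
  assumes C: "finite C" "\<And>x. x \<in> C \<Longrightarrow> pia_constraint x \<and> sat v x" and "finite {q. v q \<notin> range e}"
  shows "\<exists>w. (\<forall>q. w q \<in> cl (crit q)) \<and> finite {q. w q \<notin> range e} \<and> (\<forall>x\<in>C. sat w x)"
  using assms(2,3)
proof (induction "card {q. v q \<notin> cl (crit q)}" arbitrary: v rule: less_induct)
  case less
  let ?N = "{q. v q \<notin> cl (crit q)}"
  have "?N \<subseteq> {q. v q \<notin> range e}"
  proof (rule Collect_mono, rule impI, rule notI)
    fix q assume "v q \<notin> cl (crit q)" "v q \<in> range e"
    then show False using e_in_cl by (metis rangeE)
  qed
  then have fin: "finite ?N" using less.prems(2) by (rule finite_subset)
  show ?case
  proof (cases "?N = {}")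
    case True
    then show ?thesis using less.prems by (intro exI[of _ v]) auto
  next
    case False
    then obtain p where p: "p \<in> ?N" "\<And>r. r \<in> ?N \<Longrightarrow> \<Omega> r p \<Longrightarrow> r = p"
      using Finite_Set.bex_min_element[OF fin asymp_on_order transp_on_order False] by blast
    have below: "v r \<in> cl (crit r)" if "\<Omega> r p" for r
    proof (rule ccontr)
      assume "v r \<notin> cl (crit r)"
      then have "r = p" using p(2) that by blast
      then show False using that irrefl irreflpD by metis
    qed
    obtain c where c: "c \<in> cl (crit p)" "\<forall>x\<in>C. sat (v(p := c)) x"
      using lower_to_closed_all[OF C(1) less.prems(1) below] by blast
    let ?v = "v(p := c)"
    have "{q. ?v q \<notin> cl (crit q)} = ?N - {p}" using c(1) by auto
    then have "card {q. ?v q \<notin> cl (crit q)} < card ?N"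
      using fin p(1) by (simp only: card_Diff1_less)
    moreover have "finite {q. ?v q \<notin> range e}"
      by (rule finite_subset[of _ "insert p {q. v q \<notin> range e}"]) (use less.prems(2) in auto)
    moreover have "pia_constraint x \<and> sat ?v x" if "x \<in> C" for x
      using that less.prems(1) c(2) by blast
    ultimately show ?thesis by (intro less.hyps)
  qed
qed

text \<open>The same induction with an \<open>\<Omega>\<close>-maximal variable, counting the values
  outside the lattice.\<close>

lemma ex_lattice_assignment:
  assumes C: "finite C" "\<And>x. x \<in> C \<Longrightarrow> pia_constraint x \<and> sat v x"
    and "finite {q. v q \<notin> range e}" "\<And>q. v q \<in> cl (crit q)"
  shows "\<exists>w. \<forall>x\<in>C. sat (\<lambda>q. e (w q)) x"
  using assms(2-4)
proof (induction "card {q. v q \<notin> range e}" arbitrary: v rule: less_induct)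
  case less
  let ?N = "{q. v q \<notin> range e}"
  note fin = less.prems(2)
  show ?case
  proof (cases "?N = {}")
    case True
    then have "v = (\<lambda>q. e (inv e (v q)))" by (auto simp: f_inv_into_f)
    then show ?thesis using less.prems(1) by metis
  next
    case False
    then obtain p where p: "p \<in> ?N" "\<And>r. r \<in> ?N \<Longrightarrow> \<Omega> p r \<Longrightarrow> r = p"
      using Finite_Set.bex_max_element[OF fin asymp_on_order transp_on_order False] by blast
    have above: "v r \<in> range e" if "\<Omega> p r" for r
    proof (rule ccontr)
      assume "v r \<notin> range e"
      then have "r = p" using p(2) that by blast
      then show False using that irrefl irreflpD by metis
    qed
    obtain a where a: "\<forall>x\<in>C. sat (v(p := e a)) x"
      using raise_to_lattice_all[OF C(1) less.prems(1) less.prems(3) above] by blast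
    let ?v = "v(p := e a)"
    have N: "{q. ?v q \<notin> range e} = ?N - {p}" by auto
    then have "card {q. ?v q \<notin> range e} < card ?N"
      using fin p(1) by (simp only: card_Diff1_less)
    moreover have "finite {q. ?v q \<notin> range e}" using N fin by simp
    moreover have "?v q \<in> cl (crit q)" for q using less.prems(3) by simp
    moreover have "pia_constraint x \<and> sat ?v x" if "x \<in> C" for x
      using that less.prems(1) a by blast
    ultimately show ?thesis by (intro less.hyps[of ?v])
  qed
qed

lemma ex_assignment:
  assumes C: "finite C" "\<And>x. x \<in> C \<Longrightarrow> pia_constraint x \<and> sat v x"
  shows "\<exists>w. \<forall>x\<in>C. sat (\<lambda>q. e (w q)) x"
proof -
  define V where "V = (\<Union>(\<sigma>, t, k)\<in>C. vars t)"
  \<comment> \<open>Only finitely many variables occur in the constraints. Sending the rest to a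
    lattice element supplies the finiteness on which the inductions rest.\<close>
  define v' where "v' q = (if q \<in> V then v q else e bot)" for q
  have "finite V" unfolding V_def using C(1) by (auto simp: finite_vars)
  then have fin: "finite {q. v' q \<notin> range e}"
    by (rule rev_finite_subset) (auto simp: v'_def)
  have "sat v' x" if x: "x \<in> C" for x
  proof -
    obtain \<sigma> t k where t: "x = (\<sigma>, t, k)" by (cases x)
    have "eval J v' t = eval J v t"
      using x t by (intro eval_cong) (auto simp: v'_def V_def)
    then show ?thesis using C(2)[OF x] t by (simp add: sat_def)
  qed
  then obtain w where "\<forall>q. w q \<in> cl (crit q)" "finite {q. w q \<notin> range e}" "\<forall>x\<in>C. sat w x"
    using ex_closed_assignment[OF C(1) _ fin] C(2) by blast
  then show ?thesis using ex_lattice_assignment[OF C(1)] C(2) by blast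
qed


section \<open>Approximating skeletons\<close>

text \<open>Approximants are described by their effect: a finite system of PIA bounds true at
  \<open>v\<close> forces the term to dominate \<open>c\<close> at every assignment satisfying it.
  No term for the skeleton has to be built.\<close>

definition approximants :: "sign \<Rightarrow> ('c, 'v) trm \<Rightarrow> ('v \<Rightarrow> 'd) \<Rightarrow> 'd set" where
  "approximants \<sigma> t v = {c. \<exists>C. finite C \<and> (\<forall>x\<in>C. pia_constraint x \<and> sat v x) \<and>
     (\<forall>w. (\<forall>x\<in>C. sat w x) \<longrightarrow> sle \<sigma> c (eval J w t))}"

lemma approximantsI:
  assumes "finite C" "\<And>x. x \<in> C \<Longrightarrow> pia_constraint x \<and> sat v x"
    and "\<And>w. \<forall>x\<in>C. sat w x \<Longrightarrow> sle \<sigma> c (eval J w t)"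
  shows "c \<in> approximants \<sigma> t v"
  unfolding approximants_def using assms by blast

lemma approximantsE:
  assumes "c \<in> approximants \<sigma> t v"
  obtains C where "finite C" "\<And>x. x \<in> C \<Longrightarrow> pia_constraint x \<and> sat v x"
    "\<And>w. \<forall>x\<in>C. sat w x \<Longrightarrow> sle \<sigma> c (eval J w t)"
  using assms unfolding approximants_def by blast

lemma sSup_approximants_mono:
  assumes le: "\<And>w. sle \<sigma> (eval J w s) (eval J w t)"
    and x: "sle \<sigma> x (sSup \<sigma> (approximants \<sigma> s v))"
  shows "sle \<sigma> x (sSup \<sigma> (approximants \<sigma> t v))"
proof -
  have "c \<in> approximants \<sigma> t v" if c: "c \<in> approximants \<sigma> s v" for c
  proof -
    obtain C where C: "finite C" "\<And>x. x \<in> C \<Longrightarrow> pia_constraint x \<and> sat v x"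
      "\<And>w. \<forall>x\<in>C. sat w x \<Longrightarrow> sle \<sigma> c (eval J w s)"
      using c by (rule approximantsE) blast
    show ?thesis
      by (rule approximantsI[OF C(1,2)]) (use sle_trans[OF C(3) le] in blast)+
  qed
  then have "sle \<sigma> (sSup \<sigma> (approximants \<sigma> s v)) (sSup \<sigma> (approximants \<sigma> t v))"
    unfolding sSup_sle_iff by (blast intro: sSup_upper)
  with x show ?thesis by (rule sle_trans)
qed

text \<open>Every closed \<open>k\<close> below the value is an approximant, certified by the single
  constraint that \<open>k\<close> bounds the term; density does the rest.\<close>

lemma approximants_pia:
  assumes "wf_trm S t" "analytic_inductive_tree S \<Omega> \<epsilon> (\<sigma>, t)" "\<not> is_skeleton S (\<sigma>, t)"
  shows "sle \<sigma> (eval J v t) (sSup \<sigma> (approximants \<sigma> t v))"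
proof (rule dense_closed_sle)
  fix k assume "k \<in> cl \<sigma>" "sle \<sigma> k (eval J v t)"
  moreover have "inductive_tree S \<Omega> \<epsilon> (\<sigma>, t)"
    using assms(2) by (simp add: analytic_inductive_tree_def)
  ultimately have "k \<in> approximants \<sigma> t v"
    using assms(1) non_skeleton_pia_tree[OF assms(2,3)]
    by (intro approximantsI[of "{(\<sigma>, t, k)}"]) (simp_all add: pia_constraint_def sat_def)
  then show "sle \<sigma> k (sSup \<sigma> (approximants \<sigma> t v))" by (rule sSup_upper)
qed

text \<open>Skeleton nodes preserve joins in their sign, so generation by approximants passes up
  from the arguments, starting at the maximal PIA-subterms.\<close>

lemma eval_sle_approximants:
  assumes "wf_trm S t" "analytic_inductive_tree S \<Omega> \<epsilon> (\<sigma>, t)"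
  shows "sle \<sigma> (eval J v t) (sSup \<sigma> (approximants \<sigma> t v))"
  using assms
proof (induction t arbitrary: \<sigma>)
  case (Conj s t)
  show ?case
  proof (cases "is_skeleton S (\<sigma>, Conj s t)")
    case True
    then have \<sigma>: "\<sigma> = Minus" by (cases \<sigma>) auto
    have "analytic_inductive_tree S \<Omega> \<epsilon> (\<sigma>, s)" "analytic_inductive_tree S \<Omega> \<epsilon> (\<sigma>, t)"
      using analytic_inductive_tree_child[OF Conj.prems(2), of 0]
        analytic_inductive_tree_child[OF Conj.prems(2), of 1] by simp_all
    note IH = Conj.IH(1)[OF _ this(1)] Conj.IH(2)[OF _ this(2)]
    have "sle \<sigma> (eval J v s) (sSup \<sigma> (approximants \<sigma> (Conj s t) v))"
      by (rule sSup_approximants_mono[OF _ IH(1)]) (use Conj.prems(1) \<sigma> in simp_all)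
    moreover have "sle \<sigma> (eval J v t) (sSup \<sigma> (approximants \<sigma> (Conj s t) v))"
      by (rule sSup_approximants_mono[OF _ IH(2)]) (use Conj.prems(1) \<sigma> in simp_all)
    ultimately show ?thesis by (simp add: \<sigma>)
  qed (rule approximants_pia[OF Conj.prems])
next
  case (Disj s t)
  show ?case
  proof (cases "is_skeleton S (\<sigma>, Disj s t)")
    case True
    then have \<sigma>: "\<sigma> = Plus" by (cases \<sigma>) auto
    have "analytic_inductive_tree S \<Omega> \<epsilon> (\<sigma>, s)" "analytic_inductive_tree S \<Omega> \<epsilon> (\<sigma>, t)"
      using analytic_inductive_tree_child[OF Disj.prems(2), of 0]
        analytic_inductive_tree_child[OF Disj.prems(2), of 1] by simp_all
    note IH = Disj.IH(1)[OF _ this(1)] Disj.IH(2)[OF _ this(2)]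
    have "sle \<sigma> (eval J v s) (sSup \<sigma> (approximants \<sigma> (Disj s t) v))"
      by (rule sSup_approximants_mono[OF _ IH(1)]) (use Disj.prems(1) \<sigma> in simp_all)
    moreover have "sle \<sigma> (eval J v t) (sSup \<sigma> (approximants \<sigma> (Disj s t) v))"
      by (rule sSup_approximants_mono[OF _ IH(2)]) (use Disj.prems(1) \<sigma> in simp_all)
    ultimately show ?thesis by (simp add: \<sigma>)
  qed (rule approximants_pia[OF Disj.prems])
next
  case (Op h ts)
  then have wf: "h \<in> fconn S \<union> gconn S" "length ts = arity S h" "\<And>i. i < arity S h \<Longrightarrow> wf_trm S (ts ! i)"
    by (auto simp: list_all_length)
  show ?case
  proof (cases "is_skeleton S (\<sigma>, Op h ts)")
    case True
    then have \<sigma>: "\<sigma> = kind h" using is_skeleton_kind[OF wf(1), of \<sigma> ts] by simp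
    let ?s = "\<lambda>i. child_sign (otype S h ! i) \<sigma>"
    show ?thesis unfolding eval.simps \<sigma>
    proof (rule J_join_generated[OF wf(1), of _ "\<lambda>i. approximants (?s i) (ts ! i) v"])
      fix i assume i: "i < arity S h"
      have "analytic_inductive_tree S \<Omega> \<epsilon> (?s i, ts ! i)"
        using analytic_inductive_tree_child[OF Op.prems(2), of i] wf(2) i by (simp only: children_Op)
      then have "sle (?s i) (eval J v (ts ! i)) (sSup (?s i) (approximants (?s i) (ts ! i) v))"
        using Op.IH wf i by (metis nth_mem)
      then show "sle (child_sign (otype S h ! i) (kind h)) (map (eval J v) ts ! i)
          (sSup (child_sign (otype S h ! i) (kind h)) (approximants (?s i) (ts ! i) v))"
        using i wf(2) \<sigma> by simp
    next
      fix cs assume cs: "length cs = arity S h" "\<And>i. i < arity S h \<Longrightarrow> cs ! i \<in> approximants (?s i) (ts ! i) v"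
      define Q where "Q i C \<longleftrightarrow> finite C \<and> (\<forall>x\<in>C. pia_constraint x \<and> sat v x) \<and>
          (\<forall>w. (\<forall>x\<in>C. sat w x) \<longrightarrow> sle (?s i) (cs ! i) (eval J w (ts ! i)))" for i C
      have "\<exists>C. Q i C" if "i < arity S h" for i
        using cs(2)[OF that] unfolding Q_def approximants_def mem_Collect_eq .
      then obtain C where "\<And>i. i < arity S h \<Longrightarrow> Q i (C i)" by metis
      note C = this[unfolded Q_def, THEN conjunct1] this[unfolded Q_def, THEN conjunct2, THEN conjunct1]
        this[unfolded Q_def, THEN conjunct2, THEN conjunct2]
      \<comment> \<open>The certificate for the compound is the union of those for the arguments,
        finite because the arity is.\<close>
      let ?C = "\<Union>i<arity S h. C i"
      have "J h cs \<in> approximants \<sigma> (Op h ts) v"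
      proof (rule approximantsI)
        show "finite ?C" using C(1) by simp
        show "pia_constraint x \<and> sat v x" if "x \<in> ?C" for x using C(2) that by blast
        show "sle \<sigma> (J h cs) (eval J w (Op h ts))" if w: "\<forall>x\<in>?C. sat w x" for w
          unfolding eval.simps
        proof (rule J_mono[OF wf(1)])
          fix i assume i: "i < arity S h"
          then have "sle (?s i) (cs ! i) (eval J w (ts ! i))" using C(3)[OF i] w by blast
          then show "sle (?s i) (cs ! i) (map (eval J w) ts ! i)" using i wf(2) by simp
        qed (use cs(1) wf(2) in simp_all)
      qed
      then show "sle (kind h) (J h cs) (sSup (kind h) (approximants (kind h) (Op h ts) v))"
        unfolding \<sigma> by (rule sSup_upper)
    qed (use wf in simp)
  qed (rule approximants_pia[OF Op.prems])
qed (rule approximants_pia; simp)+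

lemma canonical:
  assumes wf: "wf_trm S \<phi>" "wf_trm S \<psi>" and ana: "analytic_inductive S \<Omega> \<epsilon> \<phi> \<psi>"
    and holds: "holds_in I \<phi> \<psi>"
  shows "holds_in J \<phi> \<psi>"
  unfolding holds_in_def
proof
  fix v
  have "eval J v \<phi> \<le> Sup (approximants Plus \<phi> v)"
    using eval_sle_approximants[of \<phi> Plus v] wf ana by (simp add: analytic_inductive_def)
  also have "\<dots> \<le> Inf (approximants Minus \<psi> v)"
  proof (intro Sup_least Inf_greatest)
    fix c d assume "c \<in> approximants Plus \<phi> v" "d \<in> approximants Minus \<psi> v"
    obtain C where C: "finite C" "\<And>x. x \<in> C \<Longrightarrow> pia_constraint x \<and> sat v x"
      "\<And>w. \<forall>x\<in>C. sat w x \<Longrightarrow> sle Plus c (eval J w \<phi>)"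
      using \<open>c \<in> _\<close> by (rule approximantsE) blast
    obtain D where D: "finite D" "\<And>x. x \<in> D \<Longrightarrow> pia_constraint x \<and> sat v x"
      "\<And>w. \<forall>x\<in>D. sat w x \<Longrightarrow> sle Minus d (eval J w \<psi>)"
      using \<open>d \<in> _\<close> by (rule approximantsE) blast
    \<comment> \<open>Both systems hold at the same \<open>v\<close>, so a single lattice assignment
      satisfies them together, and there the assumed inequality links \<open>c\<close> to
      \<open>d\<close>.\<close>
    obtain w where w: "\<forall>x\<in>C \<union> D. sat (\<lambda>q. e (w q)) x"
      using ex_assignment[of "C \<union> D" v] C D by blast
    then have "c \<le> e (eval I w \<phi>)" "e (eval I w \<psi>) \<le> d"
      using C(3)[of "\<lambda>q. e (w q)"] D(3)[of "\<lambda>q. e (w q)"] eval_e[OF wf(1), of w]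
        eval_e[OF wf(2), of w]
      by simp_all
    moreover have "sle Plus (e (eval I w \<phi>)) (e (eval I w \<psi>))"
      unfolding e_sle_iff using holds by (simp add: holds_in_def)
    ultimately show "c \<le> d" by (simp del: e_sle_iff)
  qed
  also have "\<dots> \<le> eval J v \<psi>"
    using eval_sle_approximants[of \<psi> Minus v] wf ana by (simp add: analytic_inductive_def)
  finally show "eval J v \<phi> \<le> eval J v \<psi>" .
qed

end


theorem theorem5p4:
  fixes S :: "'c signature"
    and \<epsilon> :: "'v \<Rightarrow> variance"
    and \<Omega> :: "'v \<Rightarrow> 'v \<Rightarrow> bool"
    and \<phi> \<psi> :: "('c, 'v) trm"
    and I :: "'c \<Rightarrow> 'a list \<Rightarrow> 'a::{distrib_lattice, bounded_lattice}"
    and e :: "'a \<Rightarrow> 'd::complete_lattice"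
  assumes "le_signature S"
    and "irreflp \<Omega>" and "transp \<Omega>"
    and "wf_trm S \<phi>" and "wf_trm S \<psi>"
    and "analytic_inductive S \<Omega> \<epsilon> \<phi> \<psi>"
    and "transferable S \<epsilon> \<phi> \<psi>"
    and "normal_dle S I"
    and "canonical_extension e"
    and "holds_in I \<phi> \<psi>"
  shows "holds_in (canext_ops S e I) \<phi> \<psi>"
proof -
  interpret inductive_order e S I \<Omega> \<epsilon>
    using assms by unfold_locales auto
  show ?thesis using assms by (intro canonical)
qed

end
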